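(* Consider a Pólya urn that is tenable and balanced with balance constant $b>0$, with deterministic initial state $X_0$. Let $p\ge2$ and suppose that $\mathbb E|\xi_{ij}|^p<\infty$ for all $i,j\in\{1,\dots,q\}$. Let $\lambda$ be an eigenvalue of the intensity matrix $A$. Then there exists a constant $C_p$, not depending on $n$ (but possibly depending on $p$ and on the urn), such that for every $n\ge2$, $$\|P_\lambda(X_n-\mathbb E X_n)\|_p\le\begin{cases} C_p\,n^{1/2}, & \operatorname{Re}\lambda<b/2,\\ C_p\,n^{1/2}(\log n)^{\nu_\lambda+\frac12}, & \operatorname{Re}\lambda=b/2,\\ C_p\,n^{\operatorname{Re}\lambda/b}(\log n)^{\nu_\lambda}, & \operatorname{Re}\lambda>b/2.\end{cases}$$
   Context: Pólya urn. Fix an integer $q\ge2$ (number of colours), activities $a_1,\dots,a_q\ge0$ (zero allowed), $a=(a_1,\dots,a_q)'$, and random vectors $\xi_i=(\xi_{i1},\dots,\xi_{iq})'$ in $\mathbb R^q$, $i=1,\dots,q$ (replacement vectors; entries real, possibly negative). The urn is a Markov process $X_n=(X_{n1},\dots,X_{nq})'\in[0,\infty)^q$, $n\ge0$, with deterministic initial state $X_0$. At each step $n+1\ge1$, a colour $I_{n+1}\in\{1,\dots,q\}$ is drawn which, conditionally on the past, equals $i$ with probability $a_iX_{ni}/\sum_j a_jX_{nj}$; given the past and $I_{n+1}=i$, the increment $\Delta X_n:=X_{n+1}-X_n$ has the same distribution as $\xi_i$ and is independent of the past. The urn is tenable if for every $n\ge0$, almost surely all $X_{ni}\ge0$ and $\sum_i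 a_iX_{ni}>0$. It is balanced if there is a constant $b>0$ with $\sum_j a_j\xi_{ij}=b$ a.s. for every $i$. Intensity matrix: $A$ is the $q\times q$ matrix with entries $(A)_{ij}=a_j\,\mathbb E\,\xi_{ji}$. Its set of eigenvalues is $\sigma(A)$. For $\lambda\in\sigma(A)$, $P_\lambda$ is the spectral projection of $\mathbb C^q$ onto the generalized eigenspace $E_\lambda$ of $A$ along the direct sum of the other generalized eigenspaces; thus $\sum_{\lambda\in\sigma(A)}P_\lambda=I$, $P_\lambda P_\mu=0$ for $\lambda\ne\mu$, and $AP_\lambda=P_\lambda A=\lambda P_\lambda+N_\lambda$ with $N_\lambda=P_\lambda N_\lambda=N_\lambda P_\lambda$ nilpotent. The integer $\nu_\lambda\ge0$ is such that the largest Jordan block of $A$ with eigenvalue $\lambda$ has size $\nu_\lambda+1$ (so $N_\lambda^{\nu_\lambda+1}=0$, and $N_\lambda^{\nu_\lambda}\ne0$ if $\nu_\lambda\ge1$). For a random vector $X$, $\|X\|_p:=(\mathbb E|X|^p)^{1/p}$ with $|\cdot|$ the Euclidean norm on $\mathbb C^q$. *)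

theory Defs
  imports
    "Jordan_Normal_Form.Jordan_Normal_Form"
    "HOL-Probability.Probability"
begin

no_notation Matrix.vec_index (infixl "$" 100)

section \<open>Polya urns\<close>

text \<open>
  Colours are the elements of a finite type \<open>'q\<close>. \<open>X n\<close> is the state at time \<open>n\<close> and
  \<open>I n\<close>, for \<open>n \<ge> 1\<close>, is the colour drawn at step \<open>n\<close>; \<open>I 0\<close> plays no role.
  The past at time \<open>n\<close> is generated by \<open>X 0, \<dots>, X n\<close> and \<open>I 1, \<dots>, I n\<close>.
\<close>

definition urn_past ::
  "'w measure \<Rightarrow> (nat \<Rightarrow> 'w \<Rightarrow> real^'q) \<Rightarrow> (nat \<Rightarrow> 'w \<Rightarrow> 'q) \<Rightarrow> nat \<Rightarrow> 'w measure" where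
  "urn_past M X I n = sigma (space M)
     ({X k -` B \<inter> space M | k B. k \<le> n \<and> B \<in> sets borel} \<union>
      {I k -` S \<inter> space M | k S. 1 \<le> k \<and> k \<le> n})"

definition urn_past_draw ::
  "'w measure \<Rightarrow> (nat \<Rightarrow> 'w \<Rightarrow> real^'q) \<Rightarrow> (nat \<Rightarrow> 'w \<Rightarrow> 'q) \<Rightarrow> nat \<Rightarrow> 'w measure" where
  "urn_past_draw M X I n = sigma (space M)
     (sets (urn_past M X I n) \<union> {I (Suc n) -` S \<inter> space M | S. True})"

text \<open>
  The replacement vectors \<open>\<xi> i\<close> live on a probability space \<open>N\<close> of their own; only their
  individual laws matter. The assumption \<open>increment\<close> says that the conditional law of
  \<open>X (Suc n) - X n\<close> given the past and the colour drawn is the law of \<open>\<xi> i\<close> on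
  \<open>I (Suc n) = i\<close>, which includes its conditional independence of the past.
  Nonnegativity of the states is part of \<open>tenable\<close> below.
\<close>

locale polya_urn = prob_space M + replacement: prob_space N
  for M :: "'w measure" and N :: "'v measure" +
  fixes a :: "real^'q" and \<xi> :: "'q \<Rightarrow> 'v \<Rightarrow> real^'q" and x0 :: "real^'q"
    and X :: "nat \<Rightarrow> 'w \<Rightarrow> real^'q" and I :: "nat \<Rightarrow> 'w \<Rightarrow> 'q"
  assumes colours: "CARD('q) \<ge> 2"
    and activity_nonneg: "\<And>i. a $ i \<ge> 0"
    and replacement_measurable: "\<And>i. \<xi> i \<in> borel_measurable N"
    and state_measurable: "\<And>n. X n \<in> borel_measurable M"
    and draw_measurable: "\<And>n. n \<ge> 1 \<Longrightarrow> I n \<in> measurable M (count_space UNIV)"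
    and initial: "\<And>w. w \<in> space M \<Longrightarrow> X 0 w = x0"
    and draw: "\<And>n i. AE w in M.
      real_cond_exp M (urn_past M X I n) (indicator {w \<in> space M. I (Suc n) w = i}) w
        = a $ i * X n w $ i / (\<Sum>j\<in>UNIV. a $ j * X n w $ j)"
    and increment: "\<And>n B. B \<in> sets borel \<Longrightarrow> AE w in M.
      real_cond_exp M (urn_past_draw M X I n)
          (indicator {w \<in> space M. X (Suc n) w - X n w \<in> B}) w
        = measure (distr N borel (\<xi> (I (Suc n) w))) B"

definition tenable :: "'w measure \<Rightarrow> real^'q \<Rightarrow> (nat \<Rightarrow> 'w \<Rightarrow> real^'q) \<Rightarrow> bool" where
  "tenable M a X \<longleftrightarrow>
     (\<forall>n. AE w in M. (\<forall>i. X n w $ i \<ge> 0) \<and> (\<Sum>i\<in>UNIV. a $ i * X n w $ i) > 0)"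

definition balanced :: "'v measure \<Rightarrow> real^'q \<Rightarrow> ('q \<Rightarrow> 'v \<Rightarrow> real^'q) \<Rightarrow> real \<Rightarrow> bool" where
  "balanced N a \<xi> b \<longleftrightarrow>
     b > 0 \<and> (\<forall>i. AE v in N. (\<Sum>j\<in>UNIV. a $ j * \<xi> i v $ j) = b)"

definition intensity_matrix ::
  "'v measure \<Rightarrow> real^'q \<Rightarrow> ('q \<Rightarrow> 'v \<Rightarrow> real^'q) \<Rightarrow> complex^'q^'q" where
  "intensity_matrix N a \<xi> =
     (\<chi> i j. complex_of_real (a $ j * (\<integral>v. \<xi> j v $ i \<partial>N)))"


section \<open>Spectral projections and Jordan blocks\<close>

definition eigenvalues :: "complex^'q^'q \<Rightarrow> complex set" where
  "eigenvalues A = {\<mu>. \<exists>v. v \<noteq> 0 \<and> A *v v = \<mu> *s v}"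

definition gen_eigenspace :: "complex^'q^'q \<Rightarrow> complex \<Rightarrow> (complex^'q) set" where
  "gen_eigenspace A \<mu> = {v. \<exists>k. ((\<lambda>u. A *v u - \<mu> *s u) ^^ k) v = 0}"

text \<open>
  As \<open>\<complex>\<^sup>q\<close> is the direct sum of the generalized eigenspaces, exactly one matrix
  satisfies the following description.
\<close>

definition spectral_projection :: "complex^'q^'q \<Rightarrow> complex \<Rightarrow> complex^'q^'q" where
  "spectral_projection A \<mu> = (THE P.
     (\<forall>v\<in>gen_eigenspace A \<mu>. P *v v = v) \<and>
     (\<forall>\<kappa>\<in>eigenvalues A - {\<mu>}. \<forall>v\<in>gen_eigenspace A \<kappa>. P *v v = 0))"

text \<open>
  \<open>jordan_nf\<close> is about matrices indexed by initial segments of the natural numbers, so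
  the index type is enumerated first; changing the enumeration \<open>e\<close> conjugates the matrix by
  a permutation matrix. An entry \<open>(m, \<mu>)\<close> of \<open>blocks\<close> is a Jordan block of size \<open>m\<close> with
  eigenvalue \<open>\<mu>\<close>.
\<close>

definition has_jordan_blocks :: "complex^'q^'q \<Rightarrow> (nat \<times> complex) list \<Rightarrow> bool" where
  "has_jordan_blocks A blocks \<longleftrightarrow>
     (\<exists>e. bij_betw e {..<CARD('q)} (UNIV :: 'q set) \<and>
          jordan_nf (Matrix.mat CARD('q) CARD('q) (\<lambda>(i, j). A $ e i $ e j)) blocks)"

definition largest_jordan_block :: "complex^'q^'q \<Rightarrow> complex \<Rightarrow> nat \<Rightarrow> bool" where
  "largest_jordan_block A \<mu> m \<longleftrightarrow>
     (\<exists>blocks. has_jordan_blocks A blocks \<and>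
        (m, \<mu>) \<in> set blocks \<and> (\<forall>k. (k, \<mu>) \<in> set blocks \<longrightarrow> k \<le> m))"


section \<open>Norms\<close>

definition complex_vec :: "real^'q \<Rightarrow> complex^'q" where
  "complex_vec x = (\<chi> i. complex_of_real (x $ i))"

text \<open>
  The Bochner integral of a non-integrable function is \<open>0\<close>, so a finite \<open>p\<close>-norm has to be
  expressed by \<open>Lp_finite\<close> in addition to any bound on \<open>Lp_norm\<close>.
\<close>

definition Lp_finite :: "'w measure \<Rightarrow> real \<Rightarrow> ('w \<Rightarrow> 'b::real_normed_vector) \<Rightarrow> bool" where
  "Lp_finite M p Y \<longleftrightarrow> integrable M (\<lambda>w. norm (Y w) powr p)"

definition Lp_norm :: "'w measure \<Rightarrow> real \<Rightarrow> ('w \<Rightarrow> 'b::real_normed_vector) \<Rightarrow> real" where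
  "Lp_norm M p Y = (\<integral>w. norm (Y w) powr p \<partial>M) powr (1 / p)"

end

theory Submission
  imports Defs
begin

text \<open>
  Balance makes the total activity deterministic, \<open>W n = a \<cdot> x0 + n b\<close>, so
  \<open>V n = X n - E (X n)\<close> satisfies \<open>V (n + 1) = (I + A / W n) V n + Y n\<close> with martingale
  differences \<open>Y n\<close> that are bounded in \<open>L\<^sup>p\<close>. Hence \<open>P V n\<close>, with \<open>P\<close> the spectral projection, is the sum over
  \<open>i < n\<close> of \<open>\<Prod> (I + A / W k) P Y i\<close>, the product running over \<open>i < k < n\<close>. On the range of \<open>P\<close>
  the product is a polynomial of degree at most \<open>\<nu>\<close> in the nilpotent part of \<open>A\<close>, with coefficients of
  order \<open>(n / i)\<close> to the power \<open>Re \<mu> / b\<close> times \<open>(1 + ln (n / i)) ^ \<nu>\<close>. A Burkholder-type inequality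
  with constants independent of \<open>n\<close> bounds the squared \<open>L\<^sup>p\<close> norm by the sum of the squares of these
  coefficients, whose growth gives the three cases.
\<close>

section \<open>Moments of martingales\<close>

text \<open>The state grows with n, but the noise does not: nonnegativity makes each quotient a_i
  X_i / W at most 1, so the conditional mean increment is bounded. Writing it with the deterministic
  W n makes it linear in the state at every sample point, so the recursion for the centred state
  needs no exceptional sets. Three obstacles shape the rest. The moment inequality has to be
  iterated for squared norms: these add up over the steps with a fixed factor, whereas the triangle
  inequality would produce the sum of the coefficients instead of the sum of their squares. The
  factors 1 + \<mu> / W k may be zero or small, so the coefficients of the powers of the nilpotent
  part cannot be found by dividing by such factors; they are defined by a recursion and bounded by
  induction. The martingale inequality is scalar and real, so the projected sum is split into real
  sums, one for each degree, coordinate and real or imaginary part; their number does not depend on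
  n.\<close>

lemma one_plus_powr_le_quadratic:
  fixes p t :: real
  assumes p: "p \<ge> 2" and t: "\<bar>t\<bar> \<le> 1 / 2"
  shows "(1 + t) powr p \<le> 1 + p * t + p * p * 2 powr p * t\<^sup>2"
proof (cases "t = 0")
  case False
  define diff :: "nat \<Rightarrow> real \<Rightarrow> real" where
    "diff m x = (if m = 0 then (1 + x) powr p else if m = 1 then p * (1 + x) powr (p - 1)
       else p * (p - 1) * (1 + x) powr (p - 2))" for m x
  have "\<exists>u. (if t < 0 then t < u \<and> u < 0 else 0 < u \<and> u < t) \<and>
      (1 + t) powr p = (\<Sum>m<2. diff m 0 / fact m * (t - 0) ^ m) + diff 2 u / fact 2 * (t - 0) ^ 2"
  proof (rule Taylor[where a = "-1/2" and b = "1/2"])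
    show "\<forall>m u. m < 2 \<and> - 1 / 2 \<le> u \<and> u \<le> 1 / 2 \<longrightarrow> DERIV (diff m) u :> diff (Suc m) u"
    proof (intro allI impI)
      fix m :: nat and u :: real
      assume mu: "m < 2 \<and> - 1 / 2 \<le> u \<and> u \<le> 1 / 2"
      then have "m = 0 \<or> m = 1" by auto
      then show "DERIV (diff m) u :> diff (Suc m) u"
        using mu unfolding diff_def
        by (auto intro!: derivative_eq_intros simp: algebra_simps)
    qed
  qed (use t False in \<open>auto simp: diff_def fun_eq_iff\<close>)
  then obtain u where u: "if t < 0 then t < u \<and> u < 0 else 0 < u \<and> u < t"
    and eq: "(1 + t) powr p = 1 + p * t + p * (p - 1) * (1 + u) powr (p - 2) / 2 * t\<^sup>2"
    by (auto simp: diff_def numeral_2_eq_2)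
  \<comment> \<open>The intermediate point u lies between 0 and t, so 1 + u is positive and below 2,
    and the exponent p - 2 is nonnegative.\<close>
  have "(1 + u) powr (p - 2) \<le> 2 powr (p - 2)"
    using u t p by (intro powr_mono2) (auto split: if_splits)
  also have "\<dots> \<le> 2 powr p" by (intro powr_mono) auto
  finally have "p * (p - 1) * (1 + u) powr (p - 2) / 2 \<le> p * p * 2 powr p"
    using p by (intro order_trans[OF _ mult_mono[of "p * (p - 1)" "p * p" "(1 + u) powr (p - 2)"]])
      auto
  then have "p * (p - 1) * (1 + u) powr (p - 2) / 2 * t\<^sup>2 \<le> p * p * 2 powr p * t\<^sup>2"
    by (rule mult_right_mono) simp
  then show ?thesis using eq by linarith
qed simp

lemma abs_powr_split:
  fixes x p :: real
  shows "\<bar>x\<bar> powr p = \<bar>x\<bar> powr (p - 2) * x\<^sup>2"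
proof (cases "x = 0")
  case False
  then have "\<bar>x\<bar> powr p = \<bar>x\<bar> powr (p - 2) * \<bar>x\<bar> powr 2"
    using powr_add[of "\<bar>x\<bar>" "p - 2" 2] by simp
  moreover have "\<bar>x\<bar> powr 2 = x\<^sup>2" using False by simp
  ultimately show ?thesis by (simp only:)
qed simp

text \<open>The first-order term is kept exactly, since it is the one that has mean zero for a
  martingale difference; the rest may be crude. If |d| is at most |s| / 2, scaling by s reduces to
  \<open>one_plus_powr_le_quadratic\<close>; otherwise |s| is at most 2 |d|, and |s + d|^p is
  bounded by a multiple of |d|^p.\<close>

lemma abs_add_powr_le:
  fixes p :: real
  assumes p: "p \<ge> 2"
  obtains C where "C > 0" and
    "\<And>s d :: real. \<bar>s + d\<bar> powr p \<le> \<bar>s\<bar> powr p + p * (\<bar>s\<bar> powr (p - 2) * s * d)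
       + C * (\<bar>s\<bar> powr (p - 2) * d\<^sup>2 + \<bar>d\<bar> powr p)"
proof
  \<comment> \<open>The summands pay, in this order, for the Taylor remainder, for |s + d| \<le> 3
    |d| when d is large, and for a negative first-order term when d is large.\<close>
  define C where "C = p * p * 2 powr p + 3 powr p + 2 * p"
  have C: "C \<ge> p * p * 2 powr p" "C \<ge> 3 powr p" "C \<ge> 2 * p"
    using p by (auto simp: C_def)
  show "C > 0" using C p by linarith
  fix s d :: real
  show "\<bar>s + d\<bar> powr p \<le> \<bar>s\<bar> powr p + p * (\<bar>s\<bar> powr (p - 2) * s * d)
       + C * (\<bar>s\<bar> powr (p - 2) * d\<^sup>2 + \<bar>d\<bar> powr p)"
  proof (cases "\<bar>d\<bar> \<le> \<bar>s\<bar> / 2 \<and> s \<noteq> 0")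
    case False
    then have sd: "\<bar>s\<bar> \<le> 2 * \<bar>d\<bar>" by auto
    have "\<bar>s + d\<bar> powr p \<le> (3 * \<bar>d\<bar>) powr p"
      using sd p by (intro powr_mono2) auto
    also have "\<dots> \<le> C * \<bar>d\<bar> powr p"
      using C by (auto simp: powr_mult intro: mult_right_mono)
    finally have 1: "\<bar>s + d\<bar> powr p \<le> C * \<bar>d\<bar> powr p" .
    have "- (s * d) \<le> \<bar>s\<bar> * \<bar>d\<bar>" by (metis abs_ge_minus_self abs_mult)
    also have "\<dots> \<le> 2 * d\<^sup>2" using mult_right_mono[OF sd, of "\<bar>d\<bar>"] by (simp add: power2_eq_square)
    finally have "p * \<bar>s\<bar> powr (p - 2) * - (s * d) \<le> p * \<bar>s\<bar> powr (p - 2) * (2 * d\<^sup>2)"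
      using p by (intro mult_left_mono) auto
    also have "\<dots> \<le> C * (\<bar>s\<bar> powr (p - 2) * d\<^sup>2)"
      using mult_right_mono[OF C(3), of "\<bar>s\<bar> powr (p - 2) * d\<^sup>2"] by (simp add: mult_ac)
    finally have "0 \<le> p * (\<bar>s\<bar> powr (p - 2) * s * d) + C * (\<bar>s\<bar> powr (p - 2) * d\<^sup>2)"
      by (simp add: algebra_simps)
    moreover have "0 \<le> \<bar>s\<bar> powr p" by simp
    ultimately show ?thesis using 1 unfolding distrib_left by linarith
  next
    case True
    define t where "t = d / s"
    have d: "d = s * t" and t: "\<bar>t\<bar> \<le> 1 / 2" using True by (auto simp: t_def field_simps)
    have "\<bar>s + d\<bar> powr p = \<bar>s\<bar> powr p * (1 + t) powr p"
      using t by (simp add: d powr_mult abs_mult flip: distrib_left[of s 1 t, simplified])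
    also have "\<dots> \<le> \<bar>s\<bar> powr p * (1 + p * t + C * t\<^sup>2)"
      using one_plus_powr_le_quadratic[OF p t] mult_right_mono[OF C(1), of "t\<^sup>2"]
      by (intro mult_left_mono) auto
    also have "\<dots> = \<bar>s\<bar> powr p + p * (\<bar>s\<bar> powr (p - 2) * s * d) + C * (\<bar>s\<bar> powr (p - 2) * d\<^sup>2)"
      unfolding abs_powr_split[of s p] d by (simp add: algebra_simps power2_eq_square)
    also have "\<dots> \<le> \<bar>s\<bar> powr p + p * (\<bar>s\<bar> powr (p - 2) * s * d)
        + C * (\<bar>s\<bar> powr (p - 2) * d\<^sup>2 + \<bar>d\<bar> powr p)"
      using \<open>C > 0\<close> by (simp add: distrib_left)
    finally show ?thesis .
  qed
qed

text \<open>Young's inequality with constant 1, from comparison with the p-th power of the larger of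
  x and y. It makes the mixed terms integrable and, after normalization, takes the place of
  Hoelder's inequality.\<close>

lemma powr_mult_square_le:
  fixes x y p :: real
  assumes p: "p \<ge> 2" and x: "x \<ge> 0" and y: "y \<ge> 0"
  shows "x powr (p - 2) * y\<^sup>2 \<le> x powr p + y powr p"
    and "x powr (p - 2) * x * y \<le> x powr p + y powr p"
proof -
  have xp: "x powr p = x powr (p - 2) * x\<^sup>2" "y powr p = y powr (p - 2) * y\<^sup>2"
    using abs_powr_split[of x p] abs_powr_split[of y p] x y by auto
  have *: "x powr (p - 2) * z \<le> x powr p + y powr p" if "z \<le> (max x y)\<^sup>2" for z
  proof (cases "x \<le> y")
    case True
    then have "x powr (p - 2) * z \<le> x powr (p - 2) * y\<^sup>2"
      using that by (intro mult_left_mono) (auto simp: max_def)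
    also have "\<dots> \<le> y powr p" unfolding xp using True p x by (intro mult_right_mono powr_mono2) auto
    finally show ?thesis by (simp add: add_increasing)
  next
    case False
    then have "x powr (p - 2) * z \<le> x powr (p - 2) * x\<^sup>2"
      using that by (intro mult_left_mono) (auto simp: max_def)
    then show ?thesis using xp by (simp add: add_increasing2)
  qed
  show "x powr (p - 2) * y\<^sup>2 \<le> x powr p + y powr p"
    using x y by (intro *) (auto simp: max_def power_mono)
  show "x powr (p - 2) * x * y \<le> x powr p + y powr p"
    unfolding mult.assoc using x y by (intro *) (auto simp: max_def power2_eq_square intro: mult_mono)
qed

text \<open>The average of the two lower bounds 1 + y and 1 + y^r. In the martingale step, with r =
  p / 2, it collects a linear contribution and one of order r into a single power.\<close>

lemma powr_add_ge:
  fixes x y r :: real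
  assumes r: "r \<ge> 1" and y: "y \<ge> 0"
  shows "(1 + y) powr r \<ge> 1 + (y + y powr r) / 2"
proof -
  have "1 + y \<le> (1 + y) powr r" using powr_mono[of 1 r "1 + y"] r y by simp
  moreover have "1 + y powr r \<le> (1 + y) powr r"
  proof (cases "y = 0")
    case False
    then have y: "y > 0" using y by simp
    have "1 + y powr r = 1 + y * y powr (r - 1)" using y by (simp add: powr_diff)
    also have "\<dots> \<le> (1 + y) powr (r - 1) + y * (1 + y) powr (r - 1)"
      using y r by (intro add_mono mult_left_mono powr_mono2 ge_one_powr_ge_zero) auto
    also have "\<dots> = (1 + y) powr r" using y powr_mult_base[of "1 + y" "r - 1"] by (simp add: distrib_right)
    finally show ?thesis .
  qed simp
  moreover have "1 + (u + v) / 2 \<le> z" if "1 + u \<le> z" "1 + v \<le> z" for u v z :: real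
    using that by (simp add: field_simps)
  ultimately show ?thesis by blast
qed

text \<open>
  A one-step substitute for Burkholder's inequality: adding a martingale difference increases
  the squared \<open>L\<^sup>p\<close> norm at most by a multiple of the squared norm of the difference.
\<close>

lemma martingale_step:
  fixes p :: real
  assumes p: "p \<ge> 2"
  obtains K where "K > 0" and
    "\<And>(M :: 'w measure) S D G \<delta>. G > 0 \<Longrightarrow> \<delta> > 0 \<Longrightarrow> S \<in> borel_measurable M \<Longrightarrow> D \<in> borel_measurable M \<Longrightarrow>
      integrable M (\<lambda>w. \<bar>S w :: real\<bar> powr p) \<Longrightarrow> integrable M (\<lambda>w. \<bar>D w\<bar> powr p) \<Longrightarrow>
      (\<integral>w. \<bar>S w\<bar> powr p \<partial>M) \<le> G powr (p / 2) \<Longrightarrow> (\<integral>w. \<bar>D w\<bar> powr p \<partial>M) \<le> \<delta> powr (p / 2) \<Longrightarrow>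
      (\<integral>w. \<bar>S w\<bar> powr (p - 2) * S w * D w \<partial>M) = 0 \<Longrightarrow>
      integrable M (\<lambda>w. \<bar>S w + D w\<bar> powr p) \<and>
      (\<integral>w. \<bar>S w + D w\<bar> powr p \<partial>M) \<le> (G + K * \<delta>) powr (p / 2)"
proof -
  obtain C where C: "C > 0" and ineq:
    "\<And>s d :: real. \<bar>s + d\<bar> powr p \<le> \<bar>s\<bar> powr p + p * (\<bar>s\<bar> powr (p - 2) * s * d)
       + C * (\<bar>s\<bar> powr (p - 2) * d\<^sup>2 + \<bar>d\<bar> powr p)"
    using abs_add_powr_le[OF p] by blast
  \<comment> \<open>With y = K \<delta> / G, half of y has to pay for 2 C \<delta> / G, which needs
    4 C, and half of y^(p/2) for C (\<delta> / G)^(p/2); the summand 1 ensures K^(p/2) \<ge>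
    K.\<close>
  define K where "K = 1 + 4 * C"
  have K: "K > 0" "K \<ge> 1" "K \<ge> 4 * C" using C by (auto simp: K_def)
  show ?thesis
  proof (rule that[of K])
    fix M :: "'w measure" and S D :: "'w \<Rightarrow> real" and G \<delta> :: real
    assume G: "G > 0" and \<delta>: "\<delta> > 0" and [measurable]: "S \<in> borel_measurable M" "D \<in> borel_measurable M"
      and intS: "integrable M (\<lambda>w. \<bar>S w\<bar> powr p)" and intD: "integrable M (\<lambda>w. \<bar>D w\<bar> powr p)"
      and S: "(\<integral>w. \<bar>S w\<bar> powr p \<partial>M) \<le> G powr (p / 2)" and D: "(\<integral>w. \<bar>D w\<bar> powr p \<partial>M) \<le> \<delta> powr (p / 2)"
      and orth: "(\<integral>w. \<bar>S w\<bar> powr (p - 2) * S w * D w \<partial>M) = 0"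
    have intSD: "integrable M (\<lambda>w. \<bar>S w\<bar> powr (p - 2) * (D w)\<^sup>2)"
      by (rule Bochner_Integration.integrable_bound[OF Bochner_Integration.integrable_add[OF intS intD]])
        (use powr_mult_square_le(1)[OF p, of "\<bar>S w\<bar>" "\<bar>D w\<bar>" for w] in \<open>auto simp: abs_mult\<close>)
    have intSSD: "integrable M (\<lambda>w. \<bar>S w\<bar> powr (p - 2) * S w * D w)"
      by (rule Bochner_Integration.integrable_bound[OF Bochner_Integration.integrable_add[OF intS intD]])
        (use powr_mult_square_le(2)[OF p, of "\<bar>S w\<bar>" "\<bar>D w\<bar>" for w] in \<open>auto simp: abs_mult\<close>)
    let ?R = "\<lambda>w. \<bar>S w\<bar> powr p + p * (\<bar>S w\<bar> powr (p - 2) * S w * D w)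
         + C * (\<bar>S w\<bar> powr (p - 2) * (D w)\<^sup>2 + \<bar>D w\<bar> powr p)"
    have intR: "integrable M ?R" using intS intD intSD intSSD by auto
    have int: "integrable M (\<lambda>w. \<bar>S w + D w\<bar> powr p)"
      by (rule Bochner_Integration.integrable_bound[OF intR]) (auto intro!: order_trans[OF ineq])
    \<comment> \<open>Dividing S by sqrt G and D by sqrt \<delta> makes both p-th moments at most 1,
      so the mixed integral is at most 2 in these units.\<close>
    have "(\<integral>w. \<bar>S w\<bar> powr (p - 2) * (D w)\<^sup>2 / (G powr ((p - 2) / 2) * \<delta>) \<partial>M)
       \<le> (\<integral>w. \<bar>S w\<bar> powr p / G powr (p / 2) + \<bar>D w\<bar> powr p / \<delta> powr (p / 2) \<partial>M)"
    proof (rule integral_mono)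
      fix w
      have sqG: "(\<bar>S w\<bar> / sqrt G) powr r = \<bar>S w\<bar> powr r / G powr (r / 2)" for r
        using G by (simp add: powr_divide powr_powr flip: powr_half_sqrt)
      have sq\<delta>: "(\<bar>D w\<bar> / sqrt \<delta>) powr r = \<bar>D w\<bar> powr r / \<delta> powr (r / 2)" for r
        using \<delta> by (simp add: powr_divide powr_powr flip: powr_half_sqrt)
      show "\<bar>S w\<bar> powr (p - 2) * (D w)\<^sup>2 / (G powr ((p - 2) / 2) * \<delta>)
        \<le> \<bar>S w\<bar> powr p / G powr (p / 2) + \<bar>D w\<bar> powr p / \<delta> powr (p / 2)"
        using powr_mult_square_le(1)[OF p, of "\<bar>S w\<bar> / sqrt G" "\<bar>D w\<bar> / sqrt \<delta>"] G \<delta>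
        unfolding sqG sq\<delta> by (simp add: power_divide)
    qed (use intS intD intSD in auto)
    also have "\<dots> = (\<integral>w. \<bar>S w\<bar> powr p \<partial>M) / G powr (p / 2) + (\<integral>w. \<bar>D w\<bar> powr p \<partial>M) / \<delta> powr (p / 2)"
      using intS intD by simp
    also have "\<dots> \<le> 1 + 1"
      using S D G \<delta> by (intro add_mono) (auto simp: divide_le_eq)
    finally have SD: "(\<integral>w. \<bar>S w\<bar> powr (p - 2) * (D w)\<^sup>2 \<partial>M) \<le> 2 * (G powr ((p - 2) / 2) * \<delta>)"
      using G \<delta> by (simp add: divide_le_eq)
    define y where "y = K * \<delta> / G"
    have y: "y > 0" using K \<delta> G by (simp add: y_def)
    have "(\<integral>w. \<bar>S w + D w\<bar> powr p \<partial>M) \<le> (\<integral>w. ?R w \<partial>M)"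
      by (rule integral_mono[OF int intR ineq])
    also have "\<dots> = (\<integral>w. \<bar>S w\<bar> powr p \<partial>M) + C * ((\<integral>w. \<bar>S w\<bar> powr (p - 2) * (D w)\<^sup>2 \<partial>M) + (\<integral>w. \<bar>D w\<bar> powr p \<partial>M))"
      using intS intD intSD intSSD orth by simp
    also have "\<dots> \<le> G powr (p / 2) + C * (2 * (G powr ((p - 2) / 2) * \<delta>) + \<delta> powr (p / 2))"
      using S D SD C by (intro add_mono mult_left_mono) auto
    also have "\<dots> \<le> G powr (p / 2) * (1 + (y + y powr (p / 2)) / 2)"
    proof -
      have "G powr ((p - 2) / 2) * G = G powr (p / 2)"
        using G by (simp add: diff_divide_distrib powr_diff)
      then have "G powr (p / 2) * y = K * (G powr ((p - 2) / 2) * \<delta>)"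
        using G by (auto simp: y_def field_simps)
      moreover have "4 * C * (G powr ((p - 2) / 2) * \<delta>) \<le> K * (G powr ((p - 2) / 2) * \<delta>)"
        using K \<delta> by (intro mult_right_mono) auto
      ultimately have 1: "G powr (p / 2) * y \<ge> 4 * C * (G powr ((p - 2) / 2) * \<delta>)" by simp
      have "2 * C * \<delta> powr (p / 2) \<le> K powr (p / 2) * \<delta> powr (p / 2)"
        using K C p powr_mono[of 1 "p / 2" K] by (intro mult_right_mono) auto
      also have "\<dots> = G powr (p / 2) * y powr (p / 2)"
        using G K \<delta> by (simp add: y_def powr_divide powr_mult)
      finally show ?thesis using 1 by (simp add: algebra_simps)
    qed
    also have "\<dots> \<le> G powr (p / 2) * (1 + y) powr (p / 2)"
      using powr_add_ge[of "p / 2" y] p y by (intro mult_left_mono) auto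
    also have "\<dots> = (G * (1 + y)) powr (p / 2)" using G y by (simp add: powr_mult)
    also have "G * (1 + y) = G + K * \<delta>" using G by (simp add: y_def field_simps)
    finally show "integrable M (\<lambda>w. \<bar>S w + D w\<bar> powr p) \<and>
      (\<integral>w. \<bar>S w + D w\<bar> powr p \<partial>M) \<le> (G + K * \<delta>) powr (p / 2)" using int by simp
  qed (use K in auto)
qed

text \<open>The summand 1 on the right-hand side avoids a degenerate initial norm.\<close>

lemma martingale_sum_bound:
  fixes p B :: real and Y :: "nat \<Rightarrow> 'w \<Rightarrow> real"
  assumes p: "p \<ge> 2" and M: "prob_space M"
    and sub: "\<And>n. subalgebra M (F n)"
    and meas: "\<And>i n. i < n \<Longrightarrow> Y i \<in> borel_measurable (F n)"
    and int: "\<And>i. integrable M (\<lambda>w. \<bar>Y i w\<bar> powr p)"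
    and bound: "\<And>i. (\<integral>w. \<bar>Y i w\<bar> powr p \<partial>M) \<le> B"
    and orth: "\<And>n f. f \<in> borel_measurable (F n) \<Longrightarrow> integrable M (\<lambda>w. f w * Y n w) \<Longrightarrow>
      (\<integral>w. f w * Y n w \<partial>M) = 0"
  obtains K where "K > 0" and
    "\<And>\<gamma> g n. (\<And>i. i < n \<Longrightarrow> \<bar>\<gamma> i\<bar> \<le> g i) \<Longrightarrow> (\<And>i. i < n \<Longrightarrow> g i > 0) \<Longrightarrow>
      integrable M (\<lambda>w. \<bar>\<Sum>i<n. \<gamma> i * Y i w\<bar> powr p) \<and>
      (\<integral>w. \<bar>\<Sum>i<n. \<gamma> i * Y i w\<bar> powr p \<partial>M) \<le> (1 + K * (\<Sum>i<n. (g i)\<^sup>2)) powr (p / 2)"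
proof -
  interpret prob_space M by fact
  obtain K where K: "K > 0" and step:
    "\<And>(M :: 'w measure) S D G \<delta>. G > 0 \<Longrightarrow> \<delta> > 0 \<Longrightarrow> S \<in> borel_measurable M \<Longrightarrow> D \<in> borel_measurable M \<Longrightarrow>
      integrable M (\<lambda>w. \<bar>S w :: real\<bar> powr p) \<Longrightarrow> integrable M (\<lambda>w. \<bar>D w\<bar> powr p) \<Longrightarrow>
      (\<integral>w. \<bar>S w\<bar> powr p \<partial>M) \<le> G powr (p / 2) \<Longrightarrow> (\<integral>w. \<bar>D w\<bar> powr p \<partial>M) \<le> \<delta> powr (p / 2) \<Longrightarrow>
      (\<integral>w. \<bar>S w\<bar> powr (p - 2) * S w * D w \<partial>M) = 0 \<Longrightarrow>
      integrable M (\<lambda>w. \<bar>S w + D w\<bar> powr p) \<and>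
      (\<integral>w. \<bar>S w + D w\<bar> powr p \<partial>M) \<le> (G + K * \<delta>) powr (p / 2)"
    using martingale_step[OF p] by blast
  \<comment> \<open>The maximum keeps the bound positive, so that the one-step inequality applies
    with \<delta> > 0 even to vanishing differences.\<close>
  define B' where "B' = max 1 B"
  have B': "B' > 0" "B \<le> B'" by (auto simp: B'_def)
  have measF: "(\<lambda>w. \<Sum>i<n. \<gamma> i * Y i w) \<in> borel_measurable (F n)" for \<gamma> n
    using meas by measurable
  have measM: "f \<in> borel_measurable M" if "f \<in> borel_measurable (F n)" for f :: "'w \<Rightarrow> real" and n
    using that sub by (rule measurable_from_subalg[rotated])
  have Ymeas: "Y i \<in> borel_measurable M" for i
    using measM[OF meas[of i "Suc i"]] by simp
  show ?thesis
  \<comment> \<open>\<open>B' powr (2 / p)\<close> bounds the squared norm of each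
    difference.\<close>
  proof (rule that[of "K * B' powr (2 / p)"])
    fix \<gamma> g :: "nat \<Rightarrow> real" and n
    assume "\<And>i. i < n \<Longrightarrow> \<bar>\<gamma> i\<bar> \<le> g i" "\<And>i. i < n \<Longrightarrow> g i > 0"
    then show "integrable M (\<lambda>w. \<bar>\<Sum>i<n. \<gamma> i * Y i w\<bar> powr p) \<and>
      (\<integral>w. \<bar>\<Sum>i<n. \<gamma> i * Y i w\<bar> powr p \<partial>M) \<le> (1 + K * B' powr (2 / p) * (\<Sum>i<n. (g i)\<^sup>2)) powr (p / 2)"
    proof (induction n)
      case (Suc n)
      let ?S = "\<lambda>w. \<Sum>i<n. \<gamma> i * Y i w" and ?D = "\<lambda>w. \<gamma> n * Y n w"
      let ?G = "1 + K * B' powr (2 / p) * (\<Sum>i<n. (g i)\<^sup>2)" and ?\<delta> = "B' powr (2 / p) * (g n)\<^sup>2"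
      have IH: "integrable M (\<lambda>w. \<bar>?S w\<bar> powr p)" "(\<integral>w. \<bar>?S w\<bar> powr p \<partial>M) \<le> ?G powr (p / 2)"
        using Suc by auto
      \<comment> \<open>The positive majorant g enters the bound instead of the coefficient, which
        may vanish.\<close>
      have g: "g n > 0" "\<bar>\<gamma> n\<bar> \<le> g n" using Suc.prems by auto
      have intD: "integrable M (\<lambda>w. \<bar>?D w\<bar> powr p)"
        using int[of n] by (simp add: abs_mult powr_mult)
      have "integrable M (\<lambda>w. \<bar>?S w\<bar> powr (p - 2) * ?S w * Y n w)"
      proof (rule Bochner_Integration.integrable_bound[OF Bochner_Integration.integrable_add[OF IH(1) int[of n]]])
        show "(\<lambda>w. \<bar>?S w\<bar> powr (p - 2) * ?S w * Y n w) \<in> borel_measurable M"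
          using measM[OF measF[of \<gamma> n]] Ymeas by measurable
      qed (use powr_mult_square_le(2)[OF p, of "\<bar>?S w\<bar>" "\<bar>Y n w\<bar>" for w] in \<open>auto simp: abs_mult\<close>)
      \<comment> \<open>The test function |S|^(p-2) S depends on the earlier differences only;
        orthogonality to it removes the first-order term.\<close>
      then have "(\<integral>w. (\<bar>?S w\<bar> powr (p - 2) * ?S w) * Y n w \<partial>M) = 0"
        using measurable_compose[OF measF[of \<gamma> n], of "\<lambda>s. \<bar>s\<bar> powr (p - 2) * s" borel]
        by (intro orth) simp_all
      then have orth': "(\<integral>w. \<bar>?S w\<bar> powr (p - 2) * ?S w * ?D w \<partial>M) = 0"
        using integral_mult_right_zero[of M "\<gamma> n" "\<lambda>w. \<bar>?S w\<bar> powr (p - 2) * ?S w * Y n w"]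
        by (simp only: mult_ac)
      have "(\<integral>w. \<bar>?D w\<bar> powr p \<partial>M) = \<bar>\<gamma> n\<bar> powr p * (\<integral>w. \<bar>Y n w\<bar> powr p \<partial>M)"
        by (simp add: abs_mult powr_mult)
      also have "\<dots> \<le> g n powr p * B'"
        using g p order_trans[OF bound B'(2)] by (intro mult_mono powr_mono2) auto
      also have "\<dots> = ?\<delta> powr (p / 2)"
        using g p B' by (simp add: powr_mult powr_powr flip: powr_numeral)
      finally have D: "(\<integral>w. \<bar>?D w\<bar> powr p \<partial>M) \<le> ?\<delta> powr (p / 2)" .
      have "?G > 0" using K B' by (intro add_pos_nonneg mult_nonneg_nonneg sum_nonneg) auto
      moreover have "?\<delta> > 0" using g B' by auto
      ultimately have "integrable M (\<lambda>w. \<bar>?S w + ?D w\<bar> powr p) \<and>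
          (\<integral>w. \<bar>?S w + ?D w\<bar> powr p \<partial>M) \<le> (?G + K * ?\<delta>) powr (p / 2)"
        by (rule step[OF _ _ measM[OF measF] _ IH(1) intD IH(2) D orth']) (use Ymeas in auto)
      then show ?case by (simp add: algebra_simps)
    qed (use p in \<open>auto\<close>)
  qed (use K B' in auto)
qed

section \<open>Spectral projections\<close>

text \<open>A - \<kappa> as a map instead of a matrix, in the form that occurs in
  \<open>gen_eigenspace\<close>, so that its powers are iterates.\<close>

definition eigen_shift :: "complex^'q^'q \<Rightarrow> complex \<Rightarrow> complex^'q \<Rightarrow> complex^'q" where
  "eigen_shift A \<kappa> u = A *v u - \<kappa> *s u"

lemma gen_eigenspace_iff: "v \<in> gen_eigenspace A \<kappa> \<longleftrightarrow> (\<exists>k. (eigen_shift A \<kappa> ^^ k) v = 0)"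
  by (simp add: gen_eigenspace_def eigen_shift_def[abs_def])

lemma shift_add: "eigen_shift A \<kappa> (u + v) = eigen_shift A \<kappa> u + eigen_shift A \<kappa> v"
  by (simp add: eigen_shift_def vec.add vec.scale_right_distrib)

lemma shift_scale: "eigen_shift A \<kappa> (c *s u) = c *s eigen_shift A \<kappa> u"
  by (simp add: eigen_shift_def vec.scale vec.scale_right_diff_distrib vec.scale_left_commute)

lemma shift_pow_add: "(eigen_shift A \<kappa> ^^ k) (u + v) = (eigen_shift A \<kappa> ^^ k) u + (eigen_shift A \<kappa> ^^ k) v"
  by (induction k) (simp_all add: shift_add)

lemma shift_pow_scale: "(eigen_shift A \<kappa> ^^ k) (c *s u) = c *s (eigen_shift A \<kappa> ^^ k) u"
  by (induction k) (simp_all add: shift_scale)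

lemma shift_pow_zero [simp]: "(eigen_shift A \<kappa> ^^ k) 0 = 0"
  using shift_pow_scale[of k A \<kappa> 0 0] by simp

lemma shift_pow_sum: "(eigen_shift A \<kappa> ^^ k) (\<Sum>i\<in>S. f i) = (\<Sum>i\<in>S. (eigen_shift A \<kappa> ^^ k) (f i))"
  by (induction S rule: infinite_finite_induct) (simp_all add: shift_pow_add)

lemma shift_pow_eq_0_mono:
  assumes "(eigen_shift A \<kappa> ^^ k) u = 0" and "k \<le> l"
  shows "(eigen_shift A \<kappa> ^^ l) u = 0"
proof -
  have "(eigen_shift A \<kappa> ^^ l) u = (eigen_shift A \<kappa> ^^ (l - k)) ((eigen_shift A \<kappa> ^^ k) u)"
    using \<open>k \<le> l\<close> by (simp flip: funpow_add[THEN fun_cong, unfolded o_apply])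
  then show ?thesis using assms(1) by simp
qed

lemma shift_pow_mult_vec: "(eigen_shift A \<kappa> ^^ k) (A *v u) = A *v (eigen_shift A \<kappa> ^^ k) u"
proof (induction k)
  case (Suc k)
  then show ?case by (simp add: eigen_shift_def vec.diff vec.scale)
qed simp

lemma shift_commute_pow: "eigen_shift A \<kappa>' ((eigen_shift A \<kappa> ^^ k) u) = (eigen_shift A \<kappa> ^^ k) (eigen_shift A \<kappa>' u)"
proof -
  have "eigen_shift A \<kappa>' v = A *v v + (- \<kappa>') *s v" for v by (simp add: eigen_shift_def)
  then show ?thesis by (simp only: shift_pow_add shift_pow_scale shift_pow_mult_vec)
qed

lemma shift_pow_commute_pow:
  "(eigen_shift A \<kappa>' ^^ l) ((eigen_shift A \<kappa> ^^ k) u) = (eigen_shift A \<kappa> ^^ k) ((eigen_shift A \<kappa>' ^^ l) u)"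
  by (induction l arbitrary: u) (simp_all add: shift_commute_pow funpow_swap1)

text \<open>The last nonzero iterate is an eigenvector.\<close>

lemma eigenvector_of_gen_eigenvector:
  assumes "(eigen_shift A \<kappa> ^^ k) u = 0" and "u \<noteq> 0"
  obtains l where "(eigen_shift A \<kappa> ^^ l) u \<noteq> 0" and "eigen_shift A \<kappa> ((eigen_shift A \<kappa> ^^ l) u) = 0"
proof -
  define m where "m = (LEAST k. (eigen_shift A \<kappa> ^^ k) u = 0)"
  have m: "(eigen_shift A \<kappa> ^^ m) u = 0" unfolding m_def by (rule LeastI) fact
  with \<open>u \<noteq> 0\<close> obtain l where l: "m = Suc l" by (cases m) auto
  have "(eigen_shift A \<kappa> ^^ l) u \<noteq> 0" using not_less_Least[of l "\<lambda>k. (eigen_shift A \<kappa> ^^ k) u = 0"] l m_def by auto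
  then show ?thesis using that m l by simp
qed

lemma eigenvalue_of_gen_eigenvector:
  assumes "(eigen_shift A \<kappa> ^^ k) u = 0" and "u \<noteq> 0"
  shows "\<kappa> \<in> eigenvalues A"
  using eigenvector_of_gen_eigenvector[OF assms] unfolding eigenvalues_def eigen_shift_def by auto

text \<open>Coprimality of (x - \<kappa>)^k and the product of the (x - \<kappa>')^m, argued without
  polynomials. The last nonzero iterate of u is an eigenvector for \<kappa>, on which each factor of
  the fold acts as the nonzero scalar (\<kappa> - \<kappa>')^m; but the fold commutes with the
  iteration and therefore kills it.\<close>

lemma gen_eigenvector_zero:
  assumes \<kappa>: "\<kappa> \<notin> snd ` set bs" and k: "(eigen_shift A \<kappa> ^^ k) u = 0"
    and G: "fold (\<lambda>(m, \<kappa>'). eigen_shift A \<kappa>' ^^ m) bs u = 0"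
  shows "u = 0"
proof (rule ccontr)
  assume "u \<noteq> 0"
  then obtain l where l: "(eigen_shift A \<kappa> ^^ l) u \<noteq> 0" "eigen_shift A \<kappa> ((eigen_shift A \<kappa> ^^ l) u) = 0"
    using eigenvector_of_gen_eigenvector[OF k] by blast
  have comm: "fold (\<lambda>(m, \<kappa>'). eigen_shift A \<kappa>' ^^ m) bs ((eigen_shift A \<kappa> ^^ l) w)
      = (eigen_shift A \<kappa> ^^ l) (fold (\<lambda>(m, \<kappa>'). eigen_shift A \<kappa>' ^^ m) bs w)" for w
  proof (induction bs arbitrary: w)
    case (Cons b bs)
    obtain m \<kappa>' where b: "b = (m, \<kappa>')" by fastforce
    show ?case
      using Cons[of "(eigen_shift A \<kappa>' ^^ m) w"] shift_pow_commute_pow[of m A \<kappa>' l \<kappa> w] by (simp add: b)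
  qed simp
  have pow: "(eigen_shift A \<kappa>' ^^ m) w = (\<kappa> - \<kappa>') ^ m *s w" if "eigen_shift A \<kappa> w = 0" for w \<kappa>' m
  proof (induction m)
    case (Suc m)
    have "eigen_shift A \<kappa>' w = (\<kappa> - \<kappa>') *s w"
      using that by (simp add: eigen_shift_def vec.scale_left_diff_distrib)
    then show ?case
      by (simp only: funpow.simps o_apply Suc.IH shift_scale vec.scale_scale power_Suc mult.commute)
  qed simp
  have "fold (\<lambda>(m, \<kappa>'). eigen_shift A \<kappa>' ^^ m) bs w \<noteq> 0" if "eigen_shift A \<kappa> w = 0" "w \<noteq> 0" for w
    using \<kappa> that
  proof (induction bs arbitrary: w)
    case (Cons b bs)
    obtain m \<kappa>' where b: "b = (m, \<kappa>')" by fastforce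
    have w: "(eigen_shift A \<kappa>' ^^ m) w = (\<kappa> - \<kappa>') ^ m *s w" using Cons.prems by (intro pow)
    have "\<kappa> - \<kappa>' \<noteq> 0" using Cons.prems(1) b by auto
    then have "(\<kappa> - \<kappa>') ^ m *s w \<noteq> 0" using Cons.prems(3) by simp
    moreover have "eigen_shift A \<kappa> ((\<kappa> - \<kappa>') ^ m *s w) = 0" using Cons.prems(2) by (simp add: shift_scale)
    ultimately show ?case using Cons.IH[of "(\<kappa> - \<kappa>') ^ m *s w"] Cons.prems(1) by (simp add: b w)
  qed simp
  from this[OF l(2,1)] show False unfolding comm G by simp
qed

text \<open>The factors commute, so the one that annihilates u may act first.\<close>

lemma fold_shift_eq_0:
  assumes "(m, \<kappa>) \<in> set bs" and "(eigen_shift A \<kappa> ^^ m) u = 0"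
  shows "fold (\<lambda>(m, \<kappa>'). eigen_shift A \<kappa>' ^^ m) bs u = 0"
proof -
  have zero: "fold (\<lambda>(m, \<kappa>'). eigen_shift A \<kappa>' ^^ m) bs 0 = 0" for bs
    by (induction bs) (auto simp: case_prod_beta)
  from assms show ?thesis
  proof (induction bs arbitrary: u)
    case (Cons b bs)
    obtain m' \<kappa>' where b: "b = (m', \<kappa>')" by fastforce
    show ?case
    proof (cases "b = (m, \<kappa>)")
      case True
      then show ?thesis using Cons.prems(2) zero by simp
    next
      case False
      then have "(m, \<kappa>) \<in> set bs" using Cons.prems(1) by auto
      moreover have "(eigen_shift A \<kappa> ^^ m) ((eigen_shift A \<kappa>' ^^ m') u) = 0"
        unfolding shift_pow_commute_pow[of m A \<kappa> m' \<kappa>' u] Cons.prems(2) by simp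
      ultimately show ?thesis using Cons.IH by (simp add: b)
    qed
  qed simp
qed

lemma fold_shift_sum:
  "fold (\<lambda>(m, \<kappa>'). eigen_shift A \<kappa>' ^^ m) bs (\<Sum>c\<in>S. \<alpha> c *s f c)
    = (\<Sum>c\<in>S. \<alpha> c *s fold (\<lambda>(m, \<kappa>'). eigen_shift A \<kappa>' ^^ m) bs (f c))"
proof (induction bs arbitrary: f)
  case (Cons b bs)
  show ?case by (cases b) (simp add: shift_pow_sum shift_pow_scale Cons)
qed simp

section \<open>Jordan chains and the spectral projection in a Jordan basis\<close>

lemma jordan_chains:
  assumes "\<And>c. c < sum_list (map fst bs) \<Longrightarrow>
    A *v p c = (\<Sum>r < sum_list (map fst bs). jordan_matrix bs $$ (r, c) *s p r)"
    and "c < sum_list (map fst bs)"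
  shows "\<exists>k \<kappa>. (k, \<kappa>) \<in> set bs \<and> (eigen_shift A \<kappa> ^^ k) (p c) = 0"
  using assms
proof (induction bs arbitrary: p c)
  case (Cons b bs)
  obtain k \<kappa> where b: "b = (k, \<kappa>)" by fastforce
  define n where "n = sum_list (map fst bs)"
  have Ap: "A *v p c = (\<Sum>r<k. jordan_matrix (b # bs) $$ (r, c) *s p r)
      + (\<Sum>r<n. jordan_matrix (b # bs) $$ (k + r, c) *s p (k + r))" if "c < k + n" for c
  proof -
    have "(\<Sum>r<k + n. f r) = (\<Sum>r<k. f r) + (\<Sum>r<n. f (k + r))" for f :: "nat \<Rightarrow> complex^'a"
      by (induction n) (simp_all add: add.assoc)
    then show ?thesis using Cons.prems(1)[of c] that by (simp add: b n_def)
  qed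
  have J: "jordan_matrix (b # bs) $$ (r, c) =
     (if r < k then if c < k then jordan_block k \<kappa> $$ (r, c) else 0
      else if c < k then 0 else jordan_matrix bs $$ (r - k, c - k))"
    if "r < k + n" "c < k + n" for r c
    using that by (simp add: b jordan_matrix_Cons n_def)
  show ?case
  proof (cases "c < k")
    case True
    \<comment> \<open>A Jordan block has its ones above the diagonal, so column c + 1 says A p(c+1)
      = \<kappa> p(c+1) + p(c): shifting descends along the chain, and p(c) vanishes after c + 1
      shifts.\<close>
    have "(eigen_shift A \<kappa> ^^ Suc c) (p c) = 0" using True
    proof (induction c)
      case 0
      have "A *v p 0 = (\<Sum>r<k. (if r = 0 then \<kappa> else 0) *s p r)"
        using 0 by (subst Ap) (auto simp: J intro!: sum.cong sum.neutral)
      also have "\<dots> = \<kappa> *s p 0" using 0 by (subst sum.remove[of _ 0]) auto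
      finally show ?case by (simp add: eigen_shift_def)
    next
      case (Suc c)
      have "A *v p (Suc c) = (\<Sum>r<k. (if r = Suc c then \<kappa> else if r = c then 1 else 0) *s p r)"
        using Suc.prems by (subst Ap) (auto simp: J intro!: sum.cong sum.neutral)
      also have "\<dots> = \<kappa> *s p (Suc c) + p c"
        using Suc.prems by (subst sum.remove[of _ "Suc c"], simp, simp, subst sum.remove[of _ c]) auto
      finally have "eigen_shift A \<kappa> (p (Suc c)) = p c" by (simp add: eigen_shift_def)
      then show ?case using Suc by (simp add: funpow_swap1)
    qed
    then have "(eigen_shift A \<kappa> ^^ k) (p c) = 0" by (rule shift_pow_eq_0_mono) (use True in simp)
    then show ?thesis using b by auto
  next
    case False
    define c' where "c' = c - k"
    have c': "c = k + c'" "c' < n" using False Cons.prems(2) by (auto simp: c'_def b n_def)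
    \<comment> \<open>The matrix is block diagonal, so the vectors from index k on form a system of
      the same kind for the remaining blocks.\<close>
    have "A *v p (k + c) = (\<Sum>r<n. jordan_matrix bs $$ (r, c) *s p (k + r))" if "c < n" for c
      using that by (subst Ap) (auto simp: J intro!: sum.cong sum.neutral)
    then have "\<exists>k' \<kappa>. (k', \<kappa>) \<in> set bs \<and> (eigen_shift A \<kappa> ^^ k') (p (k + c')) = 0"
      using c' by (intro Cons.IH) (auto simp: n_def)
    then show ?thesis using c' by auto
  qed
qed simp

text \<open>The columns of the similarity matrix are the vectors p, the rows of its inverse the dual
  coordinate forms q, and the two sums are the two products of these matrices. The enumeration of
  the index type is absorbed here; later arguments no longer see it.\<close>

lemma jordan_basis:
  fixes A :: "complex^'q^'q"
  assumes "has_jordan_blocks A bs"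
  obtains p :: "nat \<Rightarrow> complex^'q" and q :: "nat \<Rightarrow> 'q \<Rightarrow> complex"
  where "\<And>c. c < CARD('q) \<Longrightarrow> \<exists>k \<kappa>. (k, \<kappa>) \<in> set bs \<and> (eigen_shift A \<kappa> ^^ k) (p c) = 0"
    and "\<And>i j. (\<Sum>c<CARD('q). p c $ i * q c j) = (if i = j then 1 else 0)"
    and "\<And>c d. c < CARD('q) \<Longrightarrow> d < CARD('q) \<Longrightarrow> (\<Sum>j\<in>UNIV. q c j * p d $ j) = (if c = d then 1 else 0)"
proof -
  define n where "n = CARD('q)"
  obtain e where e: "bij_betw e {..<n} (UNIV :: 'q set)"
    and jnf: "jordan_nf (Matrix.mat n n (\<lambda>(i, j). A $ e i $ e j)) bs"
    using assms by (auto simp: has_jordan_blocks_def n_def)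
  let ?A = "Matrix.mat n n (\<lambda>(i, j). A $ e i $ e j)" and ?J = "jordan_matrix bs"
  obtain P Q where PQ: "P * Q = 1\<^sub>m n" "Q * P = 1\<^sub>m n" "?A = P * ?J * Q"
    and car: "P \<in> carrier_mat n n" "Q \<in> carrier_mat n n" "?J \<in> carrier_mat n n"
    using jnf unfolding jordan_nf_def similar_mat_def similar_mat_wit_def Let_def by auto
  have n: "sum_list (map fst bs) = n" using car(3) by auto
  have "?A * P = (P * ?J) * (Q * P)"
    using car unfolding PQ(3) by (subst assoc_mult_mat[where ?n\<^sub>1 = n and ?n\<^sub>2 = n and ?n\<^sub>3 = n and ?n\<^sub>4 = n]) auto
  then have AP: "?A * P = P * ?J" using right_mult_one_mat[OF mult_carrier_mat[OF car(1,3)]] by (simp add: PQ(2))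
  have mult: "(U * V) $$ (i, j) = (\<Sum>k<n. U $$ (i, k) * V $$ (k, j))"
    if "U \<in> carrier_mat n n" "V \<in> carrier_mat n n" "i < n" "j < n" for U V :: "complex Matrix.mat" and i j
    using that by (auto simp: scalar_prod_def lessThan_atLeast0 intro!: sum.cong)
  define f where "f = inv_into {..<n} e"
  have fe [simp]: "f (e i) = i" if "i < n" for i
    using that e by (simp add: f_def bij_betw_def)
  have f: "f j < n" "e (f j) = j" for j
    using e inv_into_into[of j e "{..<n}"] f_inv_into_f[of j e "{..<n}"] by (auto simp: f_def bij_betw_def)
  have sum_e: "(\<Sum>j\<in>UNIV. g j) = (\<Sum>k<n. g (e k))" for g :: "'q \<Rightarrow> complex"
    using sum.reindex_bij_betw[OF e] by metis
  define p :: "nat \<Rightarrow> complex^'q" where "p c = (\<chi> i. P $$ (f i, c))" for c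
  define q where "q c j = Q $$ (c, f j)" for c j
  have "A *v p c = (\<Sum>r<n. ?J $$ (r, c) *s p r)" if c: "c < n" for c
  proof (subst vec_eq_iff, rule allI)
    fix i
    have "(A *v p c) $ i = (\<Sum>k<n. ?A $$ (f i, k) * P $$ (k, c))"
      using f by (auto simp: matrix_vector_mult_def sum_e p_def intro!: sum.cong)
    also have "\<dots> = (?A * P) $$ (f i, c)" using car f c by (subst mult) auto
    also have "\<dots> = (\<Sum>r<n. P $$ (f i, r) * ?J $$ (r, c))" unfolding AP using car f c by (subst mult) auto
    finally show "(A *v p c) $ i = (\<Sum>r<n. ?J $$ (r, c) *s p r) $ i" by (simp add: p_def mult.commute)
  qed
  then have 1: "\<exists>k \<kappa>. (k, \<kappa>) \<in> set bs \<and> (eigen_shift A \<kappa> ^^ k) (p c) = 0" if "c < n" for c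
    using that jordan_chains[of bs A p c] by (simp add: n)
  have 2: "(\<Sum>c<n. p c $ i * q c j) = (if i = j then 1 else 0)" for i j
  proof -
    have "(\<Sum>c<n. p c $ i * q c j) = (P * Q) $$ (f i, f j)"
      using car f by (subst mult) (auto simp: p_def q_def)
    also have "\<dots> = (if i = j then 1 else 0)" unfolding PQ using f by (auto, metis f(2))
    finally show ?thesis .
  qed
  have 3: "(\<Sum>j\<in>UNIV. q c j * p d $ j) = (if c = d then 1 else 0)" if "c < n" "d < n" for c d
  proof -
    have "(\<Sum>j\<in>UNIV. q c j * p d $ j) = (Q * P) $$ (c, d)"
      using car f that by (subst mult) (auto simp: p_def q_def sum_e intro!: sum.cong)
    then show ?thesis unfolding PQ using that by simp
  qed
  show ?thesis using that[of p q] 1 2 3 by (simp add: n_def)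
qed

text \<open>The definite description is resolved by writing the projection P0 down in a Jordan
  basis. A matrix that fits the description agrees with P0 on the basis, because each basis vector
  is a generalized eigenvector. Both claims then reduce to basis vectors; the exponent m suffices
  because one that belongs to \<mu> stems from a block of size at most m.\<close>

lemma spectral_projection_properties:
  fixes A :: "complex^'q^'q"
  assumes "largest_jordan_block A \<mu> m"
  defines "P \<equiv> spectral_projection A \<mu>"
  shows "P *v (A *v v) = A *v (P *v v)" and "(eigen_shift A \<mu> ^^ m) (P *v v) = 0"
proof -
  obtain bs where bs: "has_jordan_blocks A bs" "\<And>k. (k, \<mu>) \<in> set bs \<Longrightarrow> k \<le> m"
    using assms by (auto simp: largest_jordan_block_def)
  define n where "n = CARD('q)"
  obtain p q where chain: "\<And>c. c < n \<Longrightarrow> \<exists>k \<kappa>. (k, \<kappa>) \<in> set bs \<and> (eigen_shift A \<kappa> ^^ k) (p c) = 0"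
    and pq: "\<And>i j. (\<Sum>c<n. p c $ i * q c j) = (if i = j then 1 else 0)"
    and qp: "\<And>c d. c < n \<Longrightarrow> d < n \<Longrightarrow> (\<Sum>j\<in>UNIV. q c j * p d $ j) = (if c = d then 1 else 0)"
    by (rule jordan_basis[OF bs(1), folded n_def]) blast
  have "\<forall>c. \<exists>k\<kappa>. c < n \<longrightarrow> k\<kappa> \<in> set bs \<and> (eigen_shift A (snd k\<kappa>) ^^ fst k\<kappa>) (p c) = 0"
    using chain by fastforce
  then obtain k\<kappa> where k\<kappa>: "\<forall>c. c < n \<longrightarrow> k\<kappa> c \<in> set bs \<and> (eigen_shift A (snd (k\<kappa> c)) ^^ fst (k\<kappa> c)) (p c) = 0"
    by (rule choice[THEN exE])
  define k \<kappa> where "k c = fst (k\<kappa> c)" and "\<kappa> c = snd (k\<kappa> c)" for c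
  have \<kappa>: "(k c, \<kappa> c) \<in> set bs" "(eigen_shift A (\<kappa> c) ^^ k c) (p c) = 0" if "c < n" for c
    using k\<kappa> that by (auto simp: k_def \<kappa>_def)
  define \<alpha> where "\<alpha> c v = (\<Sum>j\<in>UNIV. q c j * v $ j)" for c and v :: "complex^'q"
  have span: "v = (\<Sum>c<n. \<alpha> c v *s p c)" for v
  proof (subst vec_eq_iff, rule allI)
    fix i
    have "(\<Sum>c<n. \<alpha> c v *s p c) $ i = (\<Sum>c<n. \<Sum>j\<in>UNIV. v $ j * (p c $ i * q c j))"
      by (simp add: \<alpha>_def sum_distrib_left mult_ac)
    also have "\<dots> = (\<Sum>j\<in>UNIV. v $ j * (if i = j then 1 else 0))"
      by (subst sum.swap) (simp add: pq flip: sum_distrib_left)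
    also have "\<dots> = v $ i" by (simp add: if_distrib cong: if_cong)
    finally show "v $ i = (\<Sum>c<n. \<alpha> c v *s p c) $ i" by (rule sym)
  qed
  have p_nz: "p c \<noteq> 0" if "c < n" for c
    using qp[OF that that] by auto
  have p_gen: "p c \<in> gen_eigenspace A (\<kappa> c)" if "c < n" for c
    using \<kappa>(2)[OF that] by (auto simp: gen_eigenspace_iff)
  have eig: "\<kappa> c \<in> eigenvalues A" if "c < n" for c
    using eigenvalue_of_gen_eigenvector[OF \<kappa>(2) p_nz] that by blast
  have pow_sum: "\<exists>l. (eigen_shift A \<kappa>' ^^ l) (\<Sum>c\<in>{c. c < n \<and> \<kappa> c = \<kappa>'}. \<beta> c *s p c) = 0" for \<kappa>' \<beta>
  proof -
    \<comment> \<open>The sum of all k c is a common exponent for the basis vectors.\<close>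
    have "(eigen_shift A \<kappa>' ^^ (\<Sum>c<n. k c)) (p c) = 0" if "c < n" "\<kappa> c = \<kappa>'" for c
      using \<kappa>(2)[OF that(1)] that by (auto intro: member_le_sum elim!: shift_pow_eq_0_mono)
    then show ?thesis
      by (intro exI[of _ "\<Sum>c<n. k c"]) (simp add: shift_pow_sum shift_pow_scale)
  qed
  \<comment> \<open>The part ?u of v that belongs to other eigenvalues is killed by a power of A -
    \<kappa>', because v and ?w are, and also by the product over the blocks of the other
    eigenvalues; so it is zero by \<open>gen_eigenvector_zero\<close>.\<close>
  have decomp: "v = (\<Sum>c\<in>{c. c < n \<and> \<kappa> c = \<kappa>'}. \<alpha> c v *s p c)" if v_gen: "v \<in> gen_eigenspace A \<kappa>'" for v \<kappa>'
  proof -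
    let ?u = "\<Sum>c\<in>{c. c < n \<and> \<kappa> c \<noteq> \<kappa>'}. \<alpha> c v *s p c"
    let ?w = "\<Sum>c\<in>{c. c < n \<and> \<kappa> c = \<kappa>'}. \<alpha> c v *s p c"
    have "(\<Sum>c<n. \<alpha> c v *s p c) = ?w + ?u"
      by (subst sum.union_disjoint[symmetric]) (auto intro!: sum.cong)
    then have v: "v = ?w + ?u" by (simp flip: span)
    obtain l1 l2 where "(eigen_shift A \<kappa>' ^^ l1) v = 0" "(eigen_shift A \<kappa>' ^^ l2) ?w = 0"
      using v_gen pow_sum[of \<kappa>' "\<lambda>c. \<alpha> c v"] by (auto simp: gen_eigenspace_iff)
    then have "(eigen_shift A \<kappa>' ^^ (l1 + l2)) v = 0" "(eigen_shift A \<kappa>' ^^ (l1 + l2)) ?w = 0"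
      using shift_pow_eq_0_mono le_add1 le_add2 by blast+
    then have "(eigen_shift A \<kappa>' ^^ (l1 + l2)) ?u = 0"
      using shift_pow_add[of "l1 + l2" A \<kappa>' ?w ?u] by (simp flip: v)
    moreover have "fold (\<lambda>(m, \<kappa>'). eigen_shift A \<kappa>' ^^ m) (filter (\<lambda>b. snd b \<noteq> \<kappa>') bs) ?u = 0"
      unfolding fold_shift_sum by (intro sum.neutral ballI) (use \<kappa> in \<open>auto intro!: fold_shift_eq_0\<close>)
    ultimately have "?u = 0" by (rule gen_eigenvector_zero[rotated]) auto
    then show ?thesis using v by simp
  qed
  define \<chi>' :: "nat \<Rightarrow> complex" where "\<chi>' c = (if \<kappa> c = \<mu> then 1 else 0)" for c
  define P0 :: "complex^'q^'q" where "P0 = (\<chi> i j. \<Sum>c<n. \<chi>' c * p c $ i * q c j)"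
  have P0: "P0 *v v = (\<Sum>c<n. (\<chi>' c * \<alpha> c v) *s p c)" for v
  proof (subst vec_eq_iff, rule allI)
    fix i
    have "(P0 *v v) $ i = (\<Sum>j\<in>UNIV. \<Sum>c<n. \<chi>' c * p c $ i * q c j * v $ j)"
      by (simp add: P0_def matrix_vector_mult_def sum_distrib_right)
    also have "\<dots> = (\<Sum>c<n. \<Sum>j\<in>UNIV. \<chi>' c * p c $ i * q c j * v $ j)" by (rule sum.swap)
    finally show "(P0 *v v) $ i = (\<Sum>c<n. (\<chi>' c * \<alpha> c v) *s p c) $ i"
      by (simp add: \<alpha>_def sum_distrib_left sum_distrib_right mult_ac)
  qed
  have P0p: "P0 *v p c = \<chi>' c *s p c" if "c < n" for c
    unfolding P0 using that by (subst sum.remove[of _ c]) (auto simp: \<alpha>_def qp intro!: sum.neutral)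
  have char1: "P0 *v v = v" if "v \<in> gen_eigenspace A \<mu>" for v
  proof -
    have "P0 *v v = (\<Sum>c\<in>{c. c < n \<and> \<kappa> c = \<mu>}. \<alpha> c v *s (\<chi>' c *s p c))"
      by (subst decomp[OF that]) (simp add: vec.sum vec.scale P0p)
    also have "\<dots> = (\<Sum>c\<in>{c. c < n \<and> \<kappa> c = \<mu>}. \<alpha> c v *s p c)" by (simp add: \<chi>'_def)
    also have "\<dots> = v" by (rule decomp[OF that, symmetric])
    finally show ?thesis .
  qed
  have char2: "P0 *v v = 0" if "v \<in> gen_eigenspace A \<kappa>'" "\<kappa>' \<noteq> \<mu>" for v \<kappa>'
    using that(2) by (subst decomp[OF that(1)]) (auto simp: vec.sum vec.scale P0p \<chi>'_def intro!: sum.neutral)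
  have "P = P0" unfolding P_def spectral_projection_def
  proof (rule the_equality)
    fix P' assume P': "(\<forall>v\<in>gen_eigenspace A \<mu>. P' *v v = v) \<and>
      (\<forall>\<kappa>\<in>eigenvalues A - {\<mu>}. \<forall>v\<in>gen_eigenspace A \<kappa>. P' *v v = 0)"
    then have P'p: "P' *v p c = \<chi>' c *s p c" if "c < n" for c
      using p_gen[OF that] eig[OF that] by (auto simp: \<chi>'_def)
    have "P' *v (\<Sum>c<n. \<alpha> c v *s p c) = P0 *v (\<Sum>c<n. \<alpha> c v *s p c)" for v
      by (simp add: vec.sum vec.scale P'p P0p)
    then have "P' *v v = P0 *v v" for v by (simp flip: span)
    then show "P' = P0" by (simp add: matrix_eq)
  qed (use char1 char2 in auto)
  have comm: "P0 *v (A *v p c) = A *v (P0 *v p c)" if "c < n" for c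
  proof -
    have "A *v p c \<in> gen_eigenspace A (\<kappa> c)"
      unfolding gen_eigenspace_iff
      by (rule exI[of _ "k c"]) (simp add: shift_pow_mult_vec \<kappa>(2)[OF that])
    then show ?thesis using char1 char2 that by (cases "\<kappa> c = \<mu>") (auto simp: P0p \<chi>'_def)
  qed
  have "P0 *v (A *v (\<Sum>c<n. \<alpha> c v *s p c)) = A *v (P0 *v (\<Sum>c<n. \<alpha> c v *s p c))"
    by (simp add: vec.sum vec.scale comm)
  then show "P *v (A *v v) = A *v (P *v v)" by (simp add: \<open>P = P0\<close> flip: span)
  have "(eigen_shift A \<mu> ^^ m) ((\<chi>' c * \<alpha> c v) *s p c) = 0" if "c < n" for c
    using \<kappa>[OF that] bs(2) shift_pow_eq_0_mono[of "k c" A \<mu> "p c" m]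
    by (auto simp: \<chi>'_def shift_pow_scale)
  then show "(eigen_shift A \<mu> ^^ m) (P *v v) = 0"
    unfolding \<open>P = P0\<close> P0 by (simp add: shift_pow_sum)
qed

section \<open>The noise of a balanced urn\<close>

lemma abs_add_powr_le_double:
  fixes x y p :: real
  assumes "p \<ge> 0"
  shows "\<bar>x + y\<bar> powr p \<le> 2 powr p * (\<bar>x\<bar> powr p + \<bar>y\<bar> powr p)"
proof -
  have "\<bar>x + y\<bar> powr p \<le> (2 * max \<bar>x\<bar> \<bar>y\<bar>) powr p"
    using assms by (intro powr_mono2) auto
  also have "\<dots> = 2 powr p * max \<bar>x\<bar> \<bar>y\<bar> powr p" by (simp add: powr_mult)
  also have "\<dots> \<le> 2 powr p * (\<bar>x\<bar> powr p + \<bar>y\<bar> powr p)"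
    by (intro mult_left_mono) (auto simp: max_def)
  finally show ?thesis .
qed

lemma integrable_abs_powr_add:
  fixes f g :: "'w \<Rightarrow> real"
  assumes p: "p \<ge> 0" and [measurable]: "f \<in> borel_measurable M" "g \<in> borel_measurable M"
    and int: "integrable M (\<lambda>w. \<bar>f w\<bar> powr p)" "integrable M (\<lambda>w. \<bar>g w\<bar> powr p)"
  shows "integrable M (\<lambda>w. \<bar>f w + g w\<bar> powr p)"
  by (rule Bochner_Integration.integrable_bound
      [OF integrable_mult_right[OF Bochner_Integration.integrable_add[OF int], of "2 powr p"]])
    (auto intro!: order_trans[OF abs_add_powr_le_double[OF p]])

lemma (in prob_space) integrable_of_abs_powr:
  fixes f :: "'a \<Rightarrow> real"
  assumes "p \<ge> 1" and [measurable]: "f \<in> borel_measurable M" and int: "integrable M (\<lambda>w. \<bar>f w\<bar> powr p)"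
  shows "integrable M f"
proof (rule Bochner_Integration.integrable_bound)
  show "integrable M (\<lambda>w. 1 + \<bar>f w\<bar> powr p)" using int by simp
  have "\<bar>f w\<bar> \<le> 1 + \<bar>f w\<bar> powr p" for w
  proof (cases "\<bar>f w\<bar> \<le> 1")
    case False
    then show ?thesis using powr_mono[of 1 p "\<bar>f w\<bar>"] assms(1) by simp
  qed (simp add: add_increasing2)
  then show "AE w in M. norm (f w) \<le> norm (1 + \<bar>f w\<bar> powr p)" by auto
qed simp

section \<open>The conditional law of the increments\<close>

context polya_urn
begin

abbreviation "past \<equiv> urn_past M X I"
abbreviation "past_draw \<equiv> urn_past_draw M X I"
abbreviation "\<Delta> n w \<equiv> X (Suc n) w - X n w"

lemma draw_sets: "1 \<le> k \<Longrightarrow> I k -` S \<inter> space M \<in> sets M"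
  using draw_measurable[of k] by (auto intro: measurable_sets)

lemma past_generators:
  "{X k -` B \<inter> space M | k B. k \<le> n \<and> B \<in> sets borel} \<union> {I k -` S \<inter> space M | k S. 1 \<le> k \<and> k \<le> n}
    \<subseteq> sets M"
  using draw_sets measurable_sets[OF state_measurable] by auto

lemma space_past [simp]: "space (past n) = space M"
  unfolding urn_past_def by (rule space_measure_of) auto

lemma sets_past:
  "sets (past n) = sigma_sets (space M)
    ({X k -` B \<inter> space M | k B. k \<le> n \<and> B \<in> sets borel} \<union> {I k -` S \<inter> space M | k S. 1 \<le> k \<and> k \<le> n})"
  unfolding urn_past_def by (rule sets_measure_of) auto

lemma subalgebra_past: "subalgebra M (past n)"
  using sets.sigma_sets_subset[OF past_generators] by (simp add: subalgebra_def sets_past)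

lemma sets_past_subset: "sets (past n) \<subseteq> sets M"
  using subalgebra_past by (simp add: subalgebra_def)

lemma space_past_draw [simp]: "space (past_draw n) = space M"
  unfolding urn_past_draw_def using sets.space_closed[of "past n"] by (intro space_measure_of) auto

lemma sets_past_draw:
  "sets (past_draw n) = sigma_sets (space M) (sets (past n) \<union> {I (Suc n) -` S \<inter> space M | S. True})"
  unfolding urn_past_draw_def using sets.space_closed[of "past n"] by (intro sets_measure_of) auto

lemma subalgebra_past_draw: "subalgebra M (past_draw n)"
proof -
  have "sets (past n) \<union> {I (Suc n) -` S \<inter> space M | S. True} \<subseteq> sets M"
    using sets_past_subset draw_sets by auto
  then show ?thesis using sets.sigma_sets_subset[of _ M] by (simp add: subalgebra_def sets_past_draw)
qed

lemma state_past_measurable: "k \<le> n \<Longrightarrow> X k \<in> borel_measurable (past n)"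
  by (intro measurableI) (auto simp: sets_past intro!: sigma_sets.Basic)

sublocale past: sigma_finite_subalgebra M "past n" for n
  by (intro finite_measure_subalgebra_is_sigma_finite finite_measure_subalgebra.intro
      finite_measure_subalgebra_axioms.intro subalgebra_past) unfold_locales

sublocale past_draw: sigma_finite_subalgebra M "past_draw n" for n
  by (intro finite_measure_subalgebra_is_sigma_finite finite_measure_subalgebra.intro
      finite_measure_subalgebra_axioms.intro subalgebra_past_draw) unfold_locales

lemma increment_measurable [measurable]: "(\<lambda>w. \<Delta> n w) \<in> borel_measurable M"
  using state_measurable by measurable

text \<open>E fixes the colour drawn, so the conditional probability in \<open>increment\<close> is
  constant on E, and integrating it over E gives a product.\<close>

lemma measure_increment:
  assumes E: "E \<in> sets (past_draw n)" "E \<subseteq> {w. I (Suc n) w = i}" and B: "B \<in> sets borel"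
  shows "measure M (E \<inter> (\<lambda>w. \<Delta> n w) -` B) = measure M E * measure (distr N borel (\<xi> i)) B"
proof -
  let ?D = "{w \<in> space M. \<Delta> n w \<in> B}"
  have EM: "E \<in> sets M" using E subalgebra_past_draw by (auto simp: subalgebra_def)
  have D: "?D \<in> sets M" using B by measurable
  have "(\<integral>w\<in>E. (indicator ?D w :: real) \<partial>M) = (\<integral>w\<in>E. real_cond_exp M (past_draw n) (indicator ?D) w \<partial>M)"
    using E D by (intro past_draw.real_cond_exp_intA) (auto simp: integrable_indicator_iff emeasure_eq_measure)
  also have "\<dots> = (\<integral>w\<in>E. measure (distr N borel (\<xi> i)) B \<partial>M)"
    unfolding set_lebesgue_integral_def
    by (rule integral_cong_AE) (use EM increment[OF B, of n] E(2) in \<open>auto simp: indicator_def\<close>)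
  also have "\<dots> = measure M E * measure (distr N borel (\<xi> i)) B"
    using EM by (simp add: set_lebesgue_integral_def)
  also have "(\<integral>w\<in>E. (indicator ?D w :: real) \<partial>M) = measure M (E \<inter> ?D)"
    using EM D by (simp add: set_lebesgue_integral_def flip: indicator_inter_arith)
  also have "E \<inter> ?D = E \<inter> (\<lambda>w. \<Delta> n w) -` B" using sets.sets_into_space[OF EM] by auto
  finally show ?thesis .
qed

text \<open>Agreement on Borel sets becomes equality of measures, so that integrals of arbitrary
  functions follow by transport, without approximation by simple functions.\<close>

lemma distr_increment:
  assumes E: "E \<in> sets (past_draw n)" "E \<subseteq> {w. I (Suc n) w = i}"
  shows "distr (density M (\<lambda>w. ennreal (indicator E w))) borel (\<lambda>w. \<Delta> n w)
    = density (distr N borel (\<xi> i)) (\<lambda>_. ennreal (measure M E))"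
proof (rule measure_eqI)
  fix B assume "B \<in> sets (distr (density M (\<lambda>w. ennreal (indicator E w))) borel (\<lambda>w. \<Delta> n w))"
  then have B: "B \<in> sets borel" by simp
  have EM: "E \<in> sets M" using E subalgebra_past_draw by (auto simp: subalgebra_def)
  have \<Delta>B: "(\<lambda>w. \<Delta> n w) -` B \<inter> space M \<in> sets M" using B by measurable
  have "emeasure (distr (density M (\<lambda>w. ennreal (indicator E w))) borel (\<lambda>w. \<Delta> n w)) B
      = emeasure M (E \<inter> ((\<lambda>w. \<Delta> n w) -` B \<inter> space M))"
    using B EM \<Delta>B by (simp add: emeasure_distr emeasure_restricted ennreal_indicator)
  also have "E \<inter> ((\<lambda>w. \<Delta> n w) -` B \<inter> space M) = E \<inter> (\<lambda>w. \<Delta> n w) -` B"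
    using sets.sets_into_space[OF EM] by auto
  also have "emeasure M \<dots> = ennreal (measure M E * measure (distr N borel (\<xi> i)) B)"
    unfolding emeasure_eq_measure measure_increment[OF E B] ..
  also have "\<dots> = emeasure (density (distr N borel (\<xi> i)) (\<lambda>_. ennreal (measure M E))) B"
  proof -
    interpret D: prob_space "distr N borel (\<xi> i)"
      using replacement_measurable by (rule replacement.prob_space_distr)
    show ?thesis using B by (simp add: emeasure_density D.emeasure_eq_measure ennreal_mult nn_integral_cmult)
  qed
  finally show "emeasure (distr (density M (\<lambda>w. ennreal (indicator E w))) borel (\<lambda>w. \<Delta> n w)) B
    = emeasure (density (distr N borel (\<xi> i)) (\<lambda>_. ennreal (measure M E))) B" .
qed simp

lemma integral_increment_on:
  fixes f :: "real^'q \<Rightarrow> real"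
  assumes E: "E \<in> sets (past_draw n)" "E \<subseteq> {w. I (Suc n) w = i}"
    and f [measurable]: "f \<in> borel_measurable borel" and int: "integrable N (\<lambda>v. f (\<xi> i v))"
  shows "integrable M (\<lambda>w. indicator E w * f (\<Delta> n w))"
    and "(\<integral>w. indicator E w * f (\<Delta> n w) \<partial>M) = measure M E * (\<integral>v. f (\<xi> i v) \<partial>N)"
proof -
  have [measurable]: "E \<in> sets M" using E subalgebra_past_draw by (auto simp: subalgebra_def)
  note [measurable] = replacement_measurable
  let ?D = "density (distr N borel (\<xi> i)) (\<lambda>_. ennreal (measure M E))"
  have intD: "integrable (distr N borel (\<xi> i)) f" using int by (subst integrable_distr_eq) auto
  have "integrable ?D f" using intD by (subst integrable_density) auto
  moreover have "integral\<^sup>L ?D f = measure M E * (\<integral>v. f (\<xi> i v) \<partial>N)"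
    by (subst integral_density) (auto simp: integral_distr)
  ultimately show "integrable M (\<lambda>w. indicator E w * f (\<Delta> n w))"
    and "(\<integral>w. indicator E w * f (\<Delta> n w) \<partial>M) = measure M E * (\<integral>v. f (\<xi> i v) \<partial>N)"
    unfolding distr_increment[OF E, symmetric]
    by (auto simp: integrable_distr_eq integrable_density integral_distr integral_density)
qed

text \<open>E is cut into cells according to the colour drawn next. The cells belong to
  \<open>past_draw\<close>, though in general not to \<open>past\<close>, and on each of them the
  law of the increment is fixed.\<close>

lemma integral_increment_past:
  fixes f :: "real^'q \<Rightarrow> real"
  assumes E: "E \<in> sets (past n)" and f [measurable]: "f \<in> borel_measurable borel"
    and int: "\<And>i. integrable N (\<lambda>v. f (\<xi> i v))"
  shows "integrable M (\<lambda>w. indicator E w * f (\<Delta> n w))"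
    and "(\<integral>w. indicator E w * f (\<Delta> n w) \<partial>M)
      = (\<Sum>i\<in>UNIV. measure M (E \<inter> {w \<in> space M. I (Suc n) w = i}) * (\<integral>v. f (\<xi> i v) \<partial>N))"
proof -
  let ?E = "\<lambda>i. E \<inter> {w \<in> space M. I (Suc n) w = i}"
  have "{w \<in> space M. I (Suc n) w = i} \<in> sets (past_draw n)" for i
  proof -
    have "I (Suc n) -` {i} \<inter> space M \<in> sets (past_draw n)"
      unfolding sets_past_draw by (intro sigma_sets.Basic) blast
    then show ?thesis by (simp add: vimage_def Int_def conj_commute)
  qed
  moreover have "E \<in> sets (past_draw n)" using E unfolding sets_past_draw by blast
  ultimately have Ei: "?E i \<in> sets (past_draw n)" "?E i \<subseteq> {w. I (Suc n) w = i}" for i by auto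
  have split: "indicator E w * f (\<Delta> n w) = (\<Sum>i\<in>UNIV. indicator (?E i) w * f (\<Delta> n w))" if "w \<in> space M" for w
    using that by (subst sum.remove[of _ "I (Suc n) w"]) (auto simp: indicator_def intro!: sum.neutral)
  note on = integral_increment_on[OF Ei f int]
  have "integrable M (\<lambda>w. \<Sum>i\<in>UNIV. indicator (?E i) w * f (\<Delta> n w))" by (intro Bochner_Integration.integrable_sum on(1))
  then show "integrable M (\<lambda>w. indicator E w * f (\<Delta> n w))"
    by (subst Bochner_Integration.integrable_cong[OF refl split])
  have "(\<integral>w. indicator E w * f (\<Delta> n w) \<partial>M) = (\<integral>w. (\<Sum>i\<in>UNIV. indicator (?E i) w * f (\<Delta> n w)) \<partial>M)"
    by (rule Bochner_Integration.integral_cong[OF refl split])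
  also have "\<dots> = (\<Sum>i\<in>UNIV. measure M (?E i) * (\<integral>v. f (\<xi> i v) \<partial>N))"
    by (subst Bochner_Integration.integral_sum) (rule on(1), simp only: on(2))
  finally show "(\<integral>w. indicator E w * f (\<Delta> n w) \<partial>M)
      = (\<Sum>i\<in>UNIV. measure M (?E i) * (\<integral>v. f (\<xi> i v) \<partial>N))" .
qed

text \<open>The weights of the colours are probabilities, so replacing each by 1 gives a bound that
  does not depend on n.\<close>

lemma integral_increment:
  fixes f :: "real^'q \<Rightarrow> real"
  assumes f [measurable]: "f \<in> borel_measurable borel" and nn: "\<And>x. f x \<ge> 0"
    and int: "\<And>i. integrable N (\<lambda>v. f (\<xi> i v))"
  shows "integrable M (\<lambda>w. f (\<Delta> n w))"
    and "(\<integral>w. f (\<Delta> n w) \<partial>M) \<le> (\<Sum>i\<in>UNIV. \<integral>v. f (\<xi> i v) \<partial>N)"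
proof -
  have top: "space M \<in> sets (past n)" using sets.top[of "past n"] by simp
  note past = integral_increment_past[OF top f int]
  have one: "indicator (space M) w * f (\<Delta> n w) = f (\<Delta> n w)" if "w \<in> space M" for w
    using that by simp
  show "integrable M (\<lambda>w. f (\<Delta> n w))"
    using past(1) by (subst (asm) Bochner_Integration.integrable_cong[OF refl one])
  have "(\<integral>w. f (\<Delta> n w) \<partial>M) = (\<integral>w. indicator (space M) w * f (\<Delta> n w) \<partial>M)"
    by (rule Bochner_Integration.integral_cong[OF refl one[symmetric]])
  also have "\<dots> \<le> (\<Sum>i\<in>UNIV. 1 * (\<integral>v. f (\<xi> i v) \<partial>N))"
    unfolding past(2) using nn by (intro sum_mono mult_right_mono prob_le_1 Bochner_Integration.integral_nonneg) auto
  finally show "(\<integral>w. f (\<Delta> n w) \<partial>M) \<le> (\<Sum>i\<in>UNIV. \<integral>v. f (\<xi> i v) \<partial>N)" by simp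
qed

end

lemma vec_nth_measurable:
  fixes f :: "'c \<Rightarrow> real^'q"
  assumes "f \<in> borel_measurable L"
  shows "(\<lambda>w. f w $ j) \<in> borel_measurable L"
  by (rule measurable_compose[OF assms]) (intro borel_measurable_continuous_onI continuous_intros)

section \<open>Martingale differences of a balanced urn\<close>

locale balanced_urn = polya_urn M N a \<xi> x0 X I
  for M :: "'w measure" and N :: "'v measure" and a :: "real^'q" and \<xi> and x0 and X and I +
  fixes b p :: real
  assumes tenable: "tenable M a X"
    and balanced: "balanced N a \<xi> b"
    and p: "p \<ge> 2"
    and moments: "\<And>i j. integrable N (\<lambda>v. \<bar>\<xi> i v $ j\<bar> powr p)"
begin

abbreviation "w0 \<equiv> (\<Sum>j\<in>UNIV. a $ j * x0 $ j)"
abbreviation "W n \<equiv> w0 + real n * b"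
abbreviation "m i j \<equiv> (\<integral>v. \<xi> i v $ j \<partial>N)"

text \<open>The conditional mean of the increment given the past, with the total activity replaced
  by its almost sure value W n; this makes it exactly linear in the state.\<close>

definition drift :: "nat \<Rightarrow> 'w \<Rightarrow> real^'q" where
  "drift n w = (\<chi> j. \<Sum>i\<in>UNIV. a $ i * X n w $ i / W n * m i j)"

definition noise :: "nat \<Rightarrow> 'w \<Rightarrow> real^'q" where
  "noise n w = \<Delta> n w - drift n w"

lemma state_nth_measurable [measurable]: "(\<lambda>w. X n w $ j) \<in> borel_measurable M"
  using state_measurable by (rule vec_nth_measurable)

lemma b_pos: "b > 0" using balanced by (simp add: balanced_def)

text \<open>Tenability at time 0 is an almost sure statement about a constant, which on a
  probability space holds outright.\<close>

lemma w0_pos: "w0 > 0"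
proof -
  have "AE w in M. (\<Sum>i\<in>UNIV. a $ i * X 0 w $ i) > 0"
    using tenable[unfolded tenable_def, rule_format, of 0] by (auto elim: eventually_mono)
  then have "AE w in M. w0 > 0" using AE_space by eventually_elim (simp add: initial)
  then show ?thesis by simp
qed

lemma W_pos: "W n > 0"
  by (rule add_pos_nonneg[OF w0_pos]) (use b_pos in simp)

lemma replacement_integrable: "integrable N (\<lambda>v. \<xi> i v $ j)"
  by (rule replacement.integrable_of_abs_powr[OF _ vec_nth_measurable[OF replacement_measurable] moments])
    (use p in simp)

lemma increment_moment:
  "integrable M (\<lambda>w. \<bar>\<Delta> n w $ j\<bar> powr p)"
  "(\<integral>w. \<bar>\<Delta> n w $ j\<bar> powr p \<partial>M) \<le> (\<Sum>i\<in>UNIV. \<integral>v. \<bar>\<xi> i v $ j\<bar> powr p \<partial>N)"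
proof -
  have f: "(\<lambda>x::real^'q. \<bar>x $ j\<bar> powr p) \<in> borel_measurable borel"
    using vec_nth_measurable[of "\<lambda>x. x" borel j] by measurable
  show "integrable M (\<lambda>w. \<bar>\<Delta> n w $ j\<bar> powr p)"
    by (rule integral_increment(1)[OF f _ moments]) simp
  show "(\<integral>w. \<bar>\<Delta> n w $ j\<bar> powr p \<partial>M) \<le> (\<Sum>i\<in>UNIV. \<integral>v. \<bar>\<xi> i v $ j\<bar> powr p \<partial>N)"
    by (rule integral_increment(2)[OF f _ moments]) simp
qed

lemma state_moment: "integrable M (\<lambda>w. \<bar>X n w $ j\<bar> powr p)"
proof (induction n)
  case 0
  have "integrable M (\<lambda>w. \<bar>x0 $ j\<bar> powr p)" by simp
  then show ?case by (rule Bochner_Integration.integrable_cong[THEN iffD1, rotated 2]) (simp_all add: initial)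
next
  case (Suc n)
  have "integrable M (\<lambda>w. \<bar>X n w $ j + \<Delta> n w $ j\<bar> powr p)"
    using p increment_moment(1)[of n j] Suc by (intro integrable_abs_powr_add) auto
  then show ?case by simp
qed

lemma state_integrable: "integrable M (\<lambda>w. X n w $ j)"
  by (rule integrable_of_abs_powr[OF _ state_nth_measurable state_moment]) (use p in simp)

text \<open>Balance speaks of the replacement laws only. It passes to the increments through ?f, the
  indicator of the vectors that violate it: its mean is 0 under every replacement law, hence also
  for the increment.\<close>

lemma total_activity: "AE w in M. (\<Sum>i\<in>UNIV. a $ i * X n w $ i) = W n"
proof (induction n)
  case 0
  show ?case using AE_space by eventually_elim (simp add: initial)
next
  case (Suc n)
  let ?f = "\<lambda>x::real^'q. (if (\<Sum>j\<in>UNIV. a $ j * x $ j) = b then 0 else 1) :: real"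
  have [measurable]: "?f \<in> borel_measurable borel" by measurable
  have 0: "AE v in N. ?f (\<xi> i v) = 0" for i
    using balanced by (auto simp: balanced_def)
  have int: "integrable N (\<lambda>v. ?f (\<xi> i v))" "(\<integral>v. ?f (\<xi> i v) \<partial>N) = 0" for i
  proof -
    note [measurable] = replacement_measurable
    have "(\<lambda>v. ?f (\<xi> i v)) \<in> borel_measurable N" by measurable
    then show "integrable N (\<lambda>v. ?f (\<xi> i v))"
      by (rule integrable_cong_AE_imp[OF integrable_zero]) (use 0[of i] in \<open>auto elim: eventually_mono\<close>)
    show "(\<integral>v. ?f (\<xi> i v) \<partial>N) = 0" using 0[of i] by (rule integral_eq_zero_AE)
  qed
  have "(\<integral>w. ?f (\<Delta> n w) \<partial>M) \<le> (\<Sum>i\<in>UNIV. \<integral>v. ?f (\<xi> i v) \<partial>N)"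
    by (rule integral_increment(2)) (use int in auto)
  then have "(\<integral>w. ?f (\<Delta> n w) \<partial>M) = 0"
    unfolding int(2) by (intro antisym) (auto intro!: Bochner_Integration.integral_nonneg)
  moreover have "integrable M (\<lambda>w. ?f (\<Delta> n w))"
    by (rule integral_increment(1)) (use int in auto)
  ultimately have "AE w in M. ?f (\<Delta> n w) = 0"
    by (subst (asm) integral_nonneg_eq_0_iff_AE) auto
  with Suc show ?case
  proof eventually_elim
    case (elim w)
    then have "(\<Sum>j\<in>UNIV. a $ j * \<Delta> n w $ j) = b" by (metis zero_neq_one)
    then show ?case using elim(1) by (simp add: algebra_simps sum_subtractf)
  qed
qed

text \<open>The assumption \<open>draw\<close> integrated over E, with the random denominator
  replaced by W n.\<close>

lemma draw_probability:
  assumes E: "E \<in> sets (past n)"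
  shows "measure M (E \<inter> {w \<in> space M. I (Suc n) w = i}) = (\<integral>w. indicator E w * (a $ i * X n w $ i / W n) \<partial>M)"
proof -
  let ?D = "{w \<in> space M. I (Suc n) w = i}"
  have [measurable]: "E \<in> sets M" using E sets_past_subset by auto
  have [measurable]: "?D \<in> sets M" using draw_sets[of "Suc n" "{i}"] by (simp add: vimage_def Int_def conj_commute)
  note [measurable] = state_measurable
  have "measure M (E \<inter> ?D) = (\<integral>w\<in>E. (indicator ?D w :: real) \<partial>M)"
    by (simp add: set_lebesgue_integral_def flip: indicator_inter_arith)
  also have "\<dots> = (\<integral>w\<in>E. real_cond_exp M (past n) (indicator ?D) w \<partial>M)"
    using E by (intro past.real_cond_exp_intA) (auto simp: integrable_indicator_iff emeasure_eq_measure)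
  also have "\<dots> = (\<integral>w. indicator E w * (a $ i * X n w $ i / W n) \<partial>M)"
    unfolding set_lebesgue_integral_def
  proof (rule integral_cong_AE)
    show "AE w in M. indicator E w *\<^sub>R real_cond_exp M (past n) (indicator ?D) w
        = indicator E w * (a $ i * X n w $ i / W n)"
      using draw[where n = n and i = i] total_activity[of n] by eventually_elim simp
  qed auto
  finally show ?thesis .
qed

lemma drift_integrable: "integrable M (\<lambda>w. drift n w $ j)"
  unfolding drift_def vec_lambda_beta
  by (intro Bochner_Integration.integrable_sum integrable_mult_left integrable_divide integrable_mult_right
      state_integrable)

lemma noise_integrable: "integrable M (\<lambda>w. noise n w $ j)"
  unfolding noise_def vector_minus_component
  by (intro Bochner_Integration.integrable_diff state_integrable drift_integrable)

lemma noise_past_measurable: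
  assumes "n < k"
  shows "(\<lambda>w. noise n w $ j) \<in> borel_measurable (past k)"
proof -
  have [measurable]: "(\<lambda>w. X n w $ j) \<in> borel_measurable (past k)"
      "(\<lambda>w. X (Suc n) w $ j) \<in> borel_measurable (past k)" for j
    by (rule vec_nth_measurable, rule state_past_measurable, use assms in simp)+
  show ?thesis unfolding noise_def drift_def by simp
qed

text \<open>Splitting the increment by colour leaves the probabilities of the cells of E times the
  means m i j; \<open>draw_probability\<close> turns each of these probabilities into the integral
  of the weight that \<open>drift\<close> gives to m i j.\<close>

lemma noise_orthogonal_indicator:
  assumes E: "E \<in> sets (past n)"
  shows "(\<integral>w. indicator E w * noise n w $ j \<partial>M) = 0"
proof -
  have [measurable]: "E \<in> sets M" using E sets_past_subset by auto
  have intE: "integrable M (\<lambda>w. indicator E w * f w)" if "integrable M f" for f :: "'w \<Rightarrow> real"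
    using integrable_mult_indicator[OF _ that, of E] by simp
  have "(\<integral>w. indicator E w * \<Delta> n w $ j \<partial>M)
      = (\<Sum>i\<in>UNIV. (\<integral>w. indicator E w * (a $ i * X n w $ i / W n) \<partial>M) * m i j)"
    using integral_increment_past(2)[OF E, of "\<lambda>x. x $ j"] replacement_integrable
    by (simp add: draw_probability[OF E])
  also have "\<dots> = (\<Sum>i\<in>UNIV. \<integral>w. indicator E w * (a $ i * X n w $ i / W n) * m i j \<partial>M)"
    by simp
  also have "\<dots> = (\<integral>w. (\<Sum>i\<in>UNIV. indicator E w * (a $ i * X n w $ i / W n) * m i j) \<partial>M)"
    using state_integrable intE
    by (intro Bochner_Integration.integral_sum[symmetric] integrable_mult_left intE
          integrable_divide integrable_mult_right) auto
  also have "\<dots> = (\<integral>w. indicator E w * drift n w $ j \<partial>M)"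
    by (simp add: drift_def sum_distrib_left mult.assoc)
  finally have "(\<integral>w. indicator E w * \<Delta> n w $ j \<partial>M) = (\<integral>w. indicator E w * drift n w $ j \<partial>M)" .
  moreover have "(\<integral>w. indicator E w * noise n w $ j \<partial>M)
      = (\<integral>w. indicator E w * \<Delta> n w $ j - indicator E w * drift n w $ j \<partial>M)"
    by (simp add: noise_def right_diff_distrib)
  moreover have "\<dots> = (\<integral>w. indicator E w * \<Delta> n w $ j \<partial>M) - (\<integral>w. indicator E w * drift n w $ j \<partial>M)"
    using state_integrable drift_integrable by (intro Bochner_Integration.integral_diff intE) auto
  ultimately show ?thesis by simp
qed

text \<open>The test function |S|^(p-2) S of the martingale step is unbounded in general. Passing
  through the conditional expectation of the noise, which is 0, asks only for an integrable
  product.\<close>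

lemma noise_orthogonal:
  assumes f: "f \<in> borel_measurable (past n)" and int: "integrable M (\<lambda>w. f w * noise n w $ j)"
  shows "(\<integral>w. f w * noise n w $ j \<partial>M) = 0"
proof -
  have meas: "(\<lambda>w. noise n w $ j) \<in> borel_measurable M" using noise_integrable by auto
  have "AE w in M. real_cond_exp M (past n) (\<lambda>w. noise n w $ j) w = 0"
    by (rule past.real_cond_exp_charact)
      (use noise_integrable in \<open>auto simp: set_lebesgue_integral_def noise_orthogonal_indicator\<close>)
  then have "(\<integral>w. f w * real_cond_exp M (past n) (\<lambda>w. noise n w $ j) w \<partial>M) = 0"
    by (intro integral_eq_zero_AE) auto
  then show ?thesis using past.real_cond_exp_intg(2)[OF int f meas] by simp
qed

text \<open>The total W n is a sum of nonnegative terms a_i X_i, so each quotient is at most 1: the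
  drift stays bounded although the state grows.\<close>

lemma drift_bounded: "AE w in M. \<bar>drift n w $ j\<bar> \<le> (\<Sum>i\<in>UNIV. \<bar>m i j\<bar>)"
proof -
  have "AE w in M. \<forall>i. X n w $ i \<ge> 0"
    using tenable[unfolded tenable_def, rule_format, of n] by (auto elim: eventually_mono)
  with total_activity[of n] show ?thesis
  proof eventually_elim
    case (elim w)
    have "\<bar>a $ i * X n w $ i / W n\<bar> \<le> 1" for i
    proof -
      have "a $ i * X n w $ i \<le> W n"
        unfolding elim(1)[symmetric] using elim(2) activity_nonneg by (intro member_le_sum) auto
      then show ?thesis using elim(2) activity_nonneg[of i] W_pos[of n] by (simp add: abs_mult)
    qed
    note weight = this
    have "\<bar>a $ i * X n w $ i / W n * m i j\<bar> \<le> \<bar>m i j\<bar>" for i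
      using mult_right_mono[OF weight[of i] abs_ge_zero[of "m i j"]]
      unfolding abs_mult[of "a $ i * X n w $ i / W n"] by simp
    then show ?case
      unfolding drift_def by (simp only: vec_lambda_beta) (intro order_trans[OF sum_abs] sum_mono)
  qed
qed

lemma noise_moment:
  obtains B where "\<And>n j. integrable M (\<lambda>w. \<bar>noise n w $ j\<bar> powr p)"
    and "\<And>n j. (\<integral>w. \<bar>noise n w $ j\<bar> powr p \<partial>M) \<le> B"
proof -
  \<comment> \<open>Summing over j as well makes both constants independent of the
    coordinate.\<close>
  define D where "D = (\<Sum>j\<in>UNIV. \<Sum>i\<in>UNIV. \<bar>m i j\<bar>)"
  define L where "L = (\<Sum>j\<in>UNIV. \<Sum>i\<in>UNIV. \<integral>v. \<bar>\<xi> i v $ j\<bar> powr p \<partial>N)"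
  have int: "integrable M (\<lambda>w. 2 powr p * (\<bar>\<Delta> n w $ j\<bar> powr p + D powr p))" for n j
    using increment_moment(1)[of n j] by simp
  have "AE w in M. \<bar>noise n w $ j\<bar> powr p \<le> 2 powr p * (\<bar>\<Delta> n w $ j\<bar> powr p + D powr p)" for n j
    using drift_bounded[of n j]
  proof eventually_elim
    case (elim w)
    have "(\<Sum>i\<in>UNIV. \<bar>m i j\<bar>) \<le> D"
      unfolding D_def by (rule member_le_sum[of j UNIV "\<lambda>j. \<Sum>i\<in>UNIV. \<bar>m i j\<bar>"]) (auto intro: sum_nonneg)
    then have "\<bar>- drift n w $ j\<bar> powr p \<le> D powr p" using elim p by (intro powr_mono2) auto
    moreover have "\<bar>noise n w $ j\<bar> powr p \<le> 2 powr p * (\<bar>\<Delta> n w $ j\<bar> powr p + \<bar>- drift n w $ j\<bar> powr p)"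
      using abs_add_powr_le_double[of p "\<Delta> n w $ j" "- drift n w $ j"] p by (simp add: noise_def)
    ultimately show ?case
      by (elim order_trans) (intro mult_left_mono add_left_mono, auto)
  qed
  note bound = this
  have 1: "integrable M (\<lambda>w. \<bar>noise n w $ j\<bar> powr p)" for n j
    by (rule Bochner_Integration.integrable_bound[OF int])
      (use bound[of n j] noise_integrable[of n j] in \<open>auto elim!: eventually_mono\<close>)
  have "(\<integral>w. \<bar>noise n w $ j\<bar> powr p \<partial>M) \<le> 2 powr p * (L + D powr p)" for n j
  proof -
    have "(\<integral>w. \<bar>noise n w $ j\<bar> powr p \<partial>M) \<le> (\<integral>w. 2 powr p * (\<bar>\<Delta> n w $ j\<bar> powr p + D powr p) \<partial>M)"
      by (rule integral_mono_AE[OF 1 int bound])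
    also have "\<dots> = 2 powr p * ((\<integral>w. \<bar>\<Delta> n w $ j\<bar> powr p \<partial>M) + D powr p)"
      using increment_moment(1)[of n j] by (simp add: prob_space)
    also have "(\<integral>w. \<bar>\<Delta> n w $ j\<bar> powr p \<partial>M) \<le> L"
      unfolding L_def
      by (rule order_trans[OF increment_moment(2)
            member_le_sum[of j UNIV "\<lambda>j. \<Sum>i\<in>UNIV. \<integral>v. \<bar>\<xi> i v $ j\<bar> powr p \<partial>N"]])
        (auto intro!: sum_nonneg Bochner_Integration.integral_nonneg)
    finally show ?thesis by simp
  qed
  then show ?thesis using that 1 by blast
qed

section \<open>Linear recursion for the centred state\<close>

definition fluctuation :: "nat \<Rightarrow> 'w \<Rightarrow> real^'q" where
  "fluctuation n w = X n w - (\<integral>w'. X n w' \<partial>M)"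

lemma integral_state_nth: "(\<integral>w. X n w \<partial>M) $ j = (\<integral>w. X n w $ j \<partial>M)"
proof -
  have "integrable M (X n)"
  proof (rule Bochner_Integration.integrable_bound)
    show "integrable M (\<lambda>w. \<Sum>j\<in>UNIV. \<bar>X n w $ j\<bar>)" using state_integrable by auto
    show "AE w in M. norm (X n w) \<le> norm (\<Sum>j\<in>UNIV. \<bar>X n w $ j\<bar>)"
      using norm_le_l1_cart by (auto intro!: AE_I2 order_trans[OF norm_le_l1_cart abs_ge_self])
  qed (rule state_measurable)
  then show ?thesis by (rule integral_bounded_linear[OF bounded_linear_vec_nth, symmetric])
qed

lemma fluctuation_0: "w \<in> space M \<Longrightarrow> fluctuation 0 w = 0"
proof -
  have "(\<integral>w. X 0 w $ j \<partial>M) = x0 $ j" for j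
  proof -
    have "(\<integral>w. X 0 w $ j \<partial>M) = (\<integral>w. x0 $ j \<partial>M)"
      by (rule Bochner_Integration.integral_cong) (simp_all add: initial)
    then show ?thesis by (simp add: prob_space)
  qed
  then show "w \<in> space M \<Longrightarrow> fluctuation 0 w = 0"
    by (simp add: fluctuation_def vec_eq_iff integral_state_nth initial)
qed

text \<open>As the drift is linear in the state and the noise has mean 0, the mean obeys the same
  recursion without noise; the two are subtracted. The identity holds at every w, not just almost
  surely.\<close>

lemma fluctuation_Suc:
  "complex_vec (fluctuation (Suc n) w) = complex_vec (fluctuation n w)
    + complex_of_real (1 / W n) *s (intensity_matrix N a \<xi> *v complex_vec (fluctuation n w))
    + complex_vec (noise n w)"
proof -
  have 0: "(\<integral>w. noise n w $ j \<partial>M) = 0" for j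
    using noise_orthogonal[of "\<lambda>_. 1" n j] noise_integrable[of n j] by simp
  have E: "(\<integral>w. X (Suc n) w $ j \<partial>M)
      = (\<integral>w. X n w $ j \<partial>M) + (\<Sum>i\<in>UNIV. a $ i * (\<integral>w. X n w $ i \<partial>M) / W n * m i j)" for j
  proof -
    have "(\<integral>w. X (Suc n) w $ j \<partial>M) = (\<integral>w. X n w $ j + drift n w $ j + noise n w $ j \<partial>M)"
      by (simp add: noise_def)
    also have "\<dots> = (\<integral>w. X n w $ j \<partial>M) + (\<integral>w. drift n w $ j \<partial>M)"
      using state_integrable drift_integrable noise_integrable by (simp add: 0)
    also have "(\<integral>w. drift n w $ j \<partial>M) = (\<Sum>i\<in>UNIV. a $ i * (\<integral>w. X n w $ i \<partial>M) / W n * m i j)"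
      using state_integrable by (simp add: drift_def Bochner_Integration.integral_sum)
    finally show ?thesis .
  qed
  have "fluctuation (Suc n) w $ j = fluctuation n w $ j
      + (\<Sum>i\<in>UNIV. a $ i * fluctuation n w $ i / W n * m i j) + noise n w $ j" for j
    unfolding fluctuation_def noise_def drift_def
    by (simp add: integral_state_nth E right_diff_distrib left_diff_distrib diff_divide_distrib sum_subtractf)
  then show ?thesis
    by (simp add: vec_eq_iff complex_vec_def intensity_matrix_def matrix_vector_mult_def sum_divide_distrib
        flip: of_real_mult of_real_sum of_real_add of_real_divide)
       (simp add: mult_ac)
qed

end

section \<open>Growth of products of matrices\<close>

lemma bounded_of_square_increments:
  fixes D :: "nat \<Rightarrow> real"
  assumes "\<And>n. n \<ge> 1 \<Longrightarrow> \<bar>D (Suc n) - D n\<bar> \<le> C / (real n)\<^sup>2" and "n \<ge> 1"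
  shows "\<bar>D n\<bar> \<le> \<bar>D 1\<bar> + 2 * C"
proof -
  have C: "C \<ge> 0" using assms(1)[of 1] by simp
  \<comment> \<open>Strengthened for the induction: C / n^2 is at most 2 C (1/n - 1/(n+1)), which
    telescopes.\<close>
  have "\<bar>D n\<bar> \<le> \<bar>D 1\<bar> + 2 * C * (1 - 1 / real n)" using \<open>n \<ge> 1\<close>
  proof (induction n rule: dec_induct)
    case (step n)
    then have n: "n \<ge> 1" by simp
    have "1 / (real n)\<^sup>2 \<le> 2 * (1 / real n - 1 / real (Suc n))"
      using n by (simp add: divide_simps power2_eq_square)
    from mult_left_mono[OF this C] have "C / (real n)\<^sup>2 \<le> 2 * C * (1 / real n - 1 / real (Suc n))"
      by (simp only: times_divide_eq_right mult_1_right mult.assoc[of C, symmetric] mult.commute[of C 2])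
    then show ?case using step.IH assms(1)[OF n] by (simp add: right_diff_distrib)
  qed simp
  also have "\<dots> \<le> \<bar>D 1\<bar> + 2 * C" using C by (simp add: mult_left_le)
  finally show ?thesis .
qed

text \<open>Comparison with the harmonic series: 1/(w + n b) - 1/(n b) and 1/n - ln (1 + 1/n) are
  both of order 1/n^2, so the difference has square-type increments and stays bounded.\<close>

lemma sum_inverse_linear_asymp:
  fixes w b :: real
  assumes w: "w > 0" and b: "b > 0"
  obtains c where "\<And>n. n \<ge> 1 \<Longrightarrow> \<bar>(\<Sum>k<n. 1 / (w + real k * b)) - ln (real n) / b\<bar> \<le> c"
proof
  fix n :: nat assume n: "n \<ge> 1"
  define D where "D n = (\<Sum>k<n. 1 / (w + real k * b)) - ln (real n) / b" for n
  have "\<bar>D (Suc n) - D n\<bar> \<le> (w / b\<^sup>2 + 1 / b) / (real n)\<^sup>2" if "n \<ge> 1" for n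
  proof -
    have n: "real n \<ge> 1" using that by simp
    have "ln (real (Suc n)) - ln (real n) = ln (1 + 1 / real n)"
    proof -
      have "1 + 1 / real n = real (Suc n) / real n" using n by (simp add: field_simps)
      then show ?thesis using n by (simp add: ln_div del: of_nat_Suc)
    qed
    moreover have "ln (1 + 1 / real n) \<le> 1 / real n" using n by (intro ln_add_one_self_le_self) auto
    moreover have "1 / real n - (1 / real n)\<^sup>2 \<le> ln (1 + 1 / real n)"
      using n by (intro ln_one_plus_pos_lower_bound) auto
    ultimately have 1: "\<bar>1 / real n - (ln (real (Suc n)) - ln (real n))\<bar> \<le> 1 / (real n)\<^sup>2"
      by (simp add: power_divide)
    have "1 / (real n * b) - 1 / (w + real n * b) = w / ((real n * b) * (w + real n * b))"
      using n w b by (subst diff_frac_eq) (auto simp: add_pos_pos less_imp_neq[symmetric])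
    moreover have "\<dots> \<le> w / ((real n * b) * (real n * b))"
      using n w b by (intro divide_left_mono mult_left_mono mult_pos_pos) (auto simp: add_pos_pos)
    moreover have "0 \<le> w / ((real n * b) * (w + real n * b))" using w b by simp
    ultimately have 2: "\<bar>1 / (w + real n * b) - 1 / (real n * b)\<bar> \<le> w / b\<^sup>2 / (real n)\<^sup>2"
      by (simp add: power2_eq_square mult_ac)
    have "D (Suc n) - D n = (1 / (w + real n * b) - 1 / (real n * b))
        + (1 / real n - (ln (real (Suc n)) - ln (real n))) / b"
      using b n by (simp add: D_def diff_divide_distrib)
    also have "\<bar>\<dots>\<bar> \<le> w / b\<^sup>2 / (real n)\<^sup>2 + 1 / (real n)\<^sup>2 / b"
      using 2 divide_right_mono[OF 1, of b] b by (intro order_trans[OF abs_triangle_ineq] add_mono) (auto simp: abs_divide)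
    finally show ?thesis by (simp add: add_divide_distrib mult.commute)
  qed
  then show "\<bar>(\<Sum>k<n. 1 / (w + real k * b)) - ln (real n) / b\<bar> \<le> \<bar>D 1\<bar> + 2 * (w / b\<^sup>2 + 1 / b)"
    unfolding D_def[symmetric] using n by (rule bounded_of_square_increments)
qed

lemma sum_inverse_linear_square_bounded:
  fixes w b :: real
  assumes w: "w > 0" and b: "b > 0"
  obtains c where "\<And>n. (\<Sum>k<n. 1 / (w + real k * b)\<^sup>2) \<le> c"
proof
  fix n :: nat
  let ?s = "\<lambda>n. (\<Sum>k<n. 1 / (w + real k * b)\<^sup>2)"
  have "\<bar>?s (Suc n) - ?s n\<bar> \<le> 1 / b\<^sup>2 / (real n)\<^sup>2" if "n \<ge> 1" for n
  proof -
    have "1 / (w + real n * b)\<^sup>2 \<le> 1 / (real n * b)\<^sup>2"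
      using w b that add_pos_nonneg[OF w, of "real n * b"]
      by (intro divide_left_mono power_mono mult_pos_pos) (auto simp del: mult_pos_pos)
    then show ?thesis by (simp add: power_mult_distrib mult.commute)
  qed
  \<comment> \<open>Taken at \<open>Suc n\<close> because the increment bound starts at 1 while n
    may be 0; the sums are increasing.\<close>
  then have "\<bar>?s (Suc n)\<bar> \<le> \<bar>?s 1\<bar> + 2 * (1 / b\<^sup>2)"
    using bounded_of_square_increments[of ?s "1 / b\<^sup>2" "Suc n"] by auto
  moreover have "?s n \<le> ?s (Suc n)" by simp
  ultimately show "?s n \<le> \<bar>?s 1\<bar> + 2 * (1 / b\<^sup>2)" by linarith
qed

text \<open>
  On the generalized eigenspace of \<open>\<mu>\<close> the product of the matrices \<open>I + A / W k\<close> over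
  \<open>i < k < n\<close> is a polynomial in \<open>A - \<mu>\<close>; these are its coefficients.
\<close>

primrec propagator :: "(nat \<Rightarrow> real) \<Rightarrow> complex \<Rightarrow> nat \<Rightarrow> nat \<Rightarrow> nat \<Rightarrow> complex" where
  "propagator W \<mu> i 0 m = 0"
| "propagator W \<mu> i (Suc n) m = (if n = i \<and> m = 0 then 1 else 0)
     + (1 + \<mu> / complex_of_real (W n)) * propagator W \<mu> i n m
     + (if m = 0 then 0 else propagator W \<mu> i n (m - 1) / complex_of_real (W n))"

lemma propagator_eq_0: "n \<le> i \<Longrightarrow> propagator W \<mu> i n m = 0"
  by (induction n arbitrary: m) simp_all

text \<open>Keeping Re z instead of |z| to first order lets the real part of \<mu> decide the
  growth; the quadratic error is summable for z = \<mu> / W k when W grows linearly.\<close>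

lemma norm_one_plus_le_exp: "cmod (1 + z) \<le> exp (Re z + (cmod z)\<^sup>2 / 2)"
proof -
  have "(cmod (1 + z))\<^sup>2 = 1 + (2 * Re z + (cmod z)\<^sup>2)"
    by (simp only: cmod_power2) (simp add: power2_eq_square algebra_simps)
  also have "\<dots> \<le> exp (2 * Re z + (cmod z)\<^sup>2)" by (rule exp_ge_add_one_self)
  also have "\<dots> = (exp (Re z + (cmod z)\<^sup>2 / 2))\<^sup>2" by (simp flip: exp_double)
  finally show ?thesis by (rule power2_le_imp_le) simp
qed

text \<open>The first exponential bounds the product of the factors 1 + \<mu> / W k. Each degree
  replaces one of these factors by 1 / W k, which after summation costs a factor h n - h (Suc i).
  The constant exp (|\<mu>| / w) makes up for the replaced factor, whose bound may be below
  1.\<close>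

lemma propagator_bound:
  fixes W :: "nat \<Rightarrow> real" and w :: real
  assumes w: "w > 0" and W: "\<And>n. W n \<ge> w" and i: "i < n"
  defines "h \<equiv> \<lambda>n. \<Sum>k<n. 1 / W k" and "s \<equiv> \<lambda>n. \<Sum>k<n. 1 / (W k)\<^sup>2"
  shows "cmod (propagator W \<mu> i n m)
    \<le> exp (Re \<mu> * (h n - h (Suc i)) + (cmod \<mu>)\<^sup>2 / 2 * (s n - s (Suc i)))
      * (exp (cmod \<mu> / w) * (h n - h (Suc i))) ^ m"
  using i
proof (induction n arbitrary: m)
  case (Suc n)
  show ?case
  proof (cases "n = i")
    \<comment> \<open>For n = i only the newly entering summand is left; on the right the difference
      of h is 0, and 0 ^ 0 = 1 matches m = 0.\<close>
    case True
    then show ?thesis by (simp add: propagator_eq_0 power_0_left)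
  next
    case False
    then have i: "i < n" using Suc.prems by simp
    define K where "K = exp (cmod \<mu> / w)"
    define R where "R n = exp (Re \<mu> * (h n - h (Suc i)) + (cmod \<mu>)\<^sup>2 / 2 * (s n - s (Suc i)))" for n
    define L where "L n = K * (h n - h (Suc i))" for n
    define r where "r = exp (Re \<mu> / W n + (cmod \<mu>)\<^sup>2 / 2 / (W n)\<^sup>2)"
    have Wn: "W n > 0" using W[of n] w by linarith
    have IH: "cmod (propagator W \<mu> i n m) \<le> R n * L n ^ m" for m
      using Suc.IH[OF i] by (simp add: R_def L_def K_def)
    have Ln: "L n \<ge> 0"
    proof -
      have "h (Suc i) \<le> h n"
        unfolding h_def using i W w by (intro sum_mono2) (auto intro: order_trans[OF less_imp_le])
      then show ?thesis by (simp add: L_def K_def)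
    qed
    have RS: "R (Suc n) = R n * r"
      by (simp add: R_def r_def h_def s_def field_simps flip: exp_add)
    have LS: "L (Suc n) = L n + K / W n"
      by (simp add: L_def h_def right_diff_distrib distrib_left)
    \<comment> \<open>The recursion adds 1 / W n without a factor r; since r K is at least 1, this
      term still fits under the common factor r.\<close>
    have "1 \<le> r * K"
    proof -
      have "cmod \<mu> / W n \<le> cmod \<mu> / w" using W[of n] w by (intro divide_left_mono) (auto simp: Wn)
      moreover have "- (cmod \<mu> / W n) \<le> Re \<mu> / W n"
        using Wn abs_Re_le_cmod[of \<mu>] by (simp add: divide_simps)
      moreover have "0 \<le> (cmod \<mu>)\<^sup>2 / 2 / (W n)\<^sup>2" by simp
      ultimately have "0 \<le> (Re \<mu> / W n + (cmod \<mu>)\<^sup>2 / 2 / (W n)\<^sup>2) + cmod \<mu> / w" by linarith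
      then show ?thesis by (simp add: r_def K_def flip: exp_add)
    qed
    then have rK: "1 / W n \<le> r * (K / W n)" using Wn by (simp add: divide_right_mono)
    have pr: "cmod (1 + \<mu> / complex_of_real (W n)) \<le> r"
      using norm_one_plus_le_exp[of "\<mu> / complex_of_real (W n)"] Wn
      by (simp add: r_def norm_divide power_divide mult.commute[of 2])
    have "cmod (propagator W \<mu> i (Suc n) m)
      \<le> cmod ((1 + \<mu> / complex_of_real (W n)) * propagator W \<mu> i n m)
        + (if m = 0 then 0 else cmod (propagator W \<mu> i n (m - 1)) / W n)"
      using False Wn by (auto intro!: order_trans[OF norm_triangle_ineq] simp: norm_divide)
    also have "\<dots> \<le> r * (R n * L n ^ m) + (if m = 0 then 0 else R n * L n ^ (m - 1) / W n)"
      unfolding norm_mult using IH[of m] IH[of "m - 1"] pr Wn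
      by (intro add_mono mult_mono) (auto simp: divide_right_mono r_def)
    also have "\<dots> \<le> R n * r * (L n + K / W n) ^ m"
    proof (cases m)
      case (Suc m')
      have "R n * L n ^ m' * (1 / W n) \<le> R n * L n ^ m' * (r * (K / W n))"
        using rK Ln by (intro mult_left_mono) (auto simp: R_def)
      then have "r * (R n * L n ^ m) + R n * L n ^ m' / W n \<le> R n * r * (L n ^ m' * (L n + K / W n))"
        by (simp add: Suc algebra_simps)
      also have "\<dots> \<le> R n * r * ((L n + K / W n) ^ m' * (L n + K / W n))"
        using Ln Wn by (intro mult_left_mono mult_right_mono power_mono) (auto simp: R_def r_def K_def)
      finally show ?thesis by (simp add: Suc mult.commute)
    qed simp
    finally show ?thesis unfolding RS[symmetric] LS[symmetric] by (simp add: R_def L_def K_def)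
  qed
qed simp

text \<open>\<open>Suc i\<close> is the time at which noise i enters the state, and it keeps the
  quotient meaningful for i = 0. The 1 added to the logarithm keeps the weight positive at n = Suc
  i.\<close>

definition growth :: "real \<Rightarrow> nat \<Rightarrow> nat \<Rightarrow> nat \<Rightarrow> real" where
  "growth \<rho> \<nu> n i = (real n / real (Suc i)) powr \<rho> * (1 + ln (real n / real (Suc i))) ^ \<nu>"

lemma growth_pos: "i < n \<Longrightarrow> growth \<rho> \<nu> n i > 0"
proof -
  assume i: "i < n"
  then have "ln (real n / real (Suc i)) \<ge> 0" by simp
  then have "(1 + ln (real n / real (Suc i))) ^ \<nu> > 0" by (intro zero_less_power) linarith
  moreover have "(real n / real (Suc i)) powr \<rho> > 0" using i by simp
  ultimately show ?thesis unfolding growth_def by (rule mult_pos_pos[rotated])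
qed

text \<open>Since h n - h (Suc i) is ln (n / (i + 1)) / b up to a bounded error, the exponential
  becomes a power of n / (i + 1); all bounded errors go into C.\<close>

lemma propagator_growth:
  fixes w b :: real
  assumes w: "w > 0" and b: "b > 0"
  obtains C where "C > 0" and "\<And>i n m. i < n \<Longrightarrow> m \<le> \<nu> \<Longrightarrow>
    cmod (propagator (\<lambda>k. w + real k * b) \<mu> i n m) \<le> C * growth (Re \<mu> / b) \<nu> n i"
proof -
  define h where "h n = (\<Sum>k<n. 1 / (w + real k * b))" for n
  define s where "s n = (\<Sum>k<n. 1 / (w + real k * b)\<^sup>2)" for n
  obtain c where c: "\<And>n. n \<ge> 1 \<Longrightarrow> \<bar>h n - ln (real n) / b\<bar> \<le> c"
    using sum_inverse_linear_asymp[OF w b] unfolding h_def by blast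
  obtain c' where c': "\<And>n. s n \<le> c'"
    using sum_inverse_linear_square_bounded[OF w b] unfolding s_def by blast
  define K where "K = exp (cmod \<mu> / w) * (1 / b + 2 * c)"
  \<comment> \<open>\<open>max 1 K\<close> makes the base at least 1, so that any degree m \<le>
    \<nu> may be raised to \<nu>.\<close>
  define C where "C = exp (cmod \<mu> * (2 * c) + (cmod \<mu>)\<^sup>2 / 2 * c') * (max 1 K) ^ \<nu>"
  show ?thesis
  proof (rule that[of C])
    fix i n m :: nat assume i: "i < n" and m: "m \<le> \<nu>"
    define l where "l = ln (real n / real (Suc i))"
    have l0: "l \<ge> 0" using i by (simp add: l_def)
    have c0: "c \<ge> 0" using c[of 1] by linarith
    have l: "l = ln (real n) - ln (real (Suc i))" using i by (simp add: l_def ln_div)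
    have h: "\<bar>(h n - h (Suc i)) - l / b\<bar> \<le> 2 * c"
      using c[of n] c[of "Suc i"] i unfolding l diff_divide_distrib by linarith
    have hn: "h n - h (Suc i) \<ge> 0"
    proof -
      have "h (Suc i) \<le> h n" unfolding h_def using i w b by (intro sum_mono2) auto
      then show ?thesis by simp
    qed
    have "Re \<mu> * (h n - h (Suc i)) - Re \<mu> * (l / b) \<le> cmod \<mu> * (2 * c)"
    proof -
      have "\<bar>Re \<mu>\<bar> * \<bar>(h n - h (Suc i)) - l / b\<bar> \<le> cmod \<mu> * (2 * c)"
        using h abs_Re_le_cmod[of \<mu>] by (intro mult_mono) auto
      then show ?thesis
        unfolding abs_mult[symmetric] right_diff_distrib[symmetric] by (rule order_trans[OF abs_ge_self])
    qed
    moreover have "s (Suc i) \<ge> 0" unfolding s_def by (intro sum_nonneg) auto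
    then have "(cmod \<mu>)\<^sup>2 / 2 * (s n - s (Suc i)) \<le> (cmod \<mu>)\<^sup>2 / 2 * c'"
      using c'[of n] by (intro mult_left_mono) auto
    ultimately have "exp (Re \<mu> * (h n - h (Suc i)) + (cmod \<mu>)\<^sup>2 / 2 * (s n - s (Suc i)))
       \<le> exp (Re \<mu> * (l / b) + (cmod \<mu> * (2 * c) + (cmod \<mu>)\<^sup>2 / 2 * c'))" by simp
    also have "\<dots> = (real n / real (Suc i)) powr (Re \<mu> / b) * exp (cmod \<mu> * (2 * c) + (cmod \<mu>)\<^sup>2 / 2 * c')"
      using i by (simp add: exp_add powr_def l_def)
    finally have R: "exp (Re \<mu> * (h n - h (Suc i)) + (cmod \<mu>)\<^sup>2 / 2 * (s n - s (Suc i)))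
      \<le> (real n / real (Suc i)) powr (Re \<mu> / b) * exp (cmod \<mu> * (2 * c) + (cmod \<mu>)\<^sup>2 / 2 * c')" .
    have "h n - h (Suc i) \<le> l / b + 2 * c" using h by linarith
    also have "\<dots> \<le> (1 / b + 2 * c) * (1 + l)"
      using l0 c0 b mult_nonneg_nonneg[OF c0 l0] by (simp add: algebra_simps add_divide_distrib)
    finally have "exp (cmod \<mu> / w) * (h n - h (Suc i)) \<le> K * (1 + l)"
      unfolding K_def mult.assoc by (rule mult_left_mono) simp
    also have "\<dots> \<le> max 1 K * (1 + l)" using l0 by (intro mult_right_mono) auto
    finally have "(exp (cmod \<mu> / w) * (h n - h (Suc i))) ^ m \<le> (max 1 K * (1 + l)) ^ m"
      using hn by (intro power_mono) auto
    also have "\<dots> \<le> (max 1 K * (1 + l)) ^ \<nu>"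
      using m l0 mult_mono[of 1 "max 1 K" 1 "1 + l"] by (intro power_increasing) auto
    finally have L: "(exp (cmod \<mu> / w) * (h n - h (Suc i))) ^ m \<le> (max 1 K) ^ \<nu> * (1 + l) ^ \<nu>"
      by (simp add: power_mult_distrib)
    have "cmod (propagator (\<lambda>k. w + real k * b) \<mu> i n m)
      \<le> exp (Re \<mu> * (h n - h (Suc i)) + (cmod \<mu>)\<^sup>2 / 2 * (s n - s (Suc i)))
        * (exp (cmod \<mu> / w) * (h n - h (Suc i))) ^ m"
      unfolding h_def s_def using w b by (intro propagator_bound[OF w _ i]) auto
    also have "\<dots> \<le> ((real n / real (Suc i)) powr (Re \<mu> / b) * exp (cmod \<mu> * (2 * c) + (cmod \<mu>)\<^sup>2 / 2 * c'))
        * ((max 1 K) ^ \<nu> * (1 + l) ^ \<nu>)"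
      using hn by (intro mult_mono R L) auto
    also have "\<dots> = C * growth (Re \<mu> / b) \<nu> n i"
      by (simp add: C_def growth_def l_def mult_ac)
    finally show "cmod (propagator (\<lambda>k. w + real k * b) \<mu> i n m) \<le> C * growth (Re \<mu> / b) \<nu> n i" .
  qed (simp add: C_def)
qed

section \<open>Square sums of the growth weights in the three regimes\<close>

lemma sum_powr_less_1:
  fixes s :: real
  assumes s: "0 < s" "s < 1"
  shows "(\<Sum>i<n. (real n / real (Suc i)) powr s) \<le> real n / (1 - s)"
proof -
  \<comment> \<open>The tangent inequality for the concave function x^(1 - s), obtained from
    weighted AM-GM; its right-hand side telescopes. At n = 0 it reads 1 - s \<le> 1.\<close>
  have step: "(1 - s) * real (Suc n) powr (- s) \<le> real (Suc n) powr (1 - s) - real n powr (1 - s)" for n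
  proof (cases "n = 0")
    case False
    define N where "N = real (Suc n)"
    have N: "N > 0" "real n = N - 1" by (simp_all add: N_def)
    have "(real n / N) powr (1 - s) * 1 powr s \<le> (1 - s) * (real n / N) + s * 1"
      using s False N by (intro Youngs_inequality_0) auto
    moreover have "real n / N = 1 - 1 / N" using N by (simp add: diff_divide_distrib)
    then have "(1 - s) * (real n / N) + s * 1 = 1 - (1 - s) / N" by (simp add: right_diff_distrib)
    ultimately have "(real n / N) powr (1 - s) \<le> 1 - (1 - s) / N" by simp
    then have "N powr (1 - s) * (real n / N) powr (1 - s) \<le> N powr (1 - s) * (1 - (1 - s) / N)"
      by (rule mult_left_mono) simp
    moreover have "N powr (1 - s) * (real n / N) powr (1 - s) = real n powr (1 - s)"
      using N by (simp flip: powr_mult)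
    moreover have "(1 - s) * N powr (1 - s) / N = (1 - s) * N powr (- s)"
      using N by (simp add: powr_diff powr_minus divide_inverse)
    ultimately show ?thesis
      unfolding N_def[symmetric] by (simp add: right_diff_distrib mult.commute)
  qed (use s in simp)
  have "(1 - s) * (\<Sum>i<n. real (Suc i) powr (- s)) \<le> real n powr (1 - s)"
  proof (induction n)
    case (Suc n)
    then show ?case using step[of n] by (simp add: distrib_left)
  qed simp
  then have "real n powr s * ((1 - s) * (\<Sum>i<n. real (Suc i) powr (- s))) \<le> real n powr s * real n powr (1 - s)"
    by (rule mult_left_mono) simp
  also have "\<dots> = real n" by (cases "n = 0") (simp_all flip: powr_add)
  finally have "(\<Sum>i<n. real n powr s * real (Suc i) powr (- s)) * (1 - s) \<le> real n"
    unfolding sum_distrib_left[symmetric] by (simp only: mult.left_commute mult.commute[of _ "1 - s"])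
  moreover have "real n powr s * real (Suc i) powr (- s) = (real n / real (Suc i)) powr s" for i
    using powr_divide[of "real n" "real (Suc i)" s] by (simp add: powr_minus_divide)
  ultimately have "(\<Sum>i<n. (real n / real (Suc i)) powr s) * (1 - s) \<le> real n" by (simp only:)
  then show ?thesis using s by (simp only: pos_le_divide_eq diff_gt_0_iff_gt)
qed

text \<open>This is ln y \<le> y - 1 at y = x^\<delta>. It lets an arbitrarily small power absorb
  the logarithms.\<close>

lemma one_plus_ln_le_powr:
  fixes x \<delta> :: real
  assumes x: "x \<ge> 1" and \<delta>: "0 < \<delta>" "\<delta> \<le> 1"
  shows "1 + ln x \<le> x powr \<delta> / \<delta>"
proof -
  have "\<delta> * ln x \<le> x powr \<delta> - 1"
    using x ln_le_minus_one[of "x powr \<delta>"] by (simp add: ln_powr)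
  then have "\<delta> * (1 + ln x) \<le> x powr \<delta>" using \<delta> by (simp add: distrib_left)
  then show ?thesis using \<delta> by (simp add: field_simps)
qed

lemma sum_inverse_le_ln:
  assumes "n \<ge> 1"
  shows "(\<Sum>i<n. 1 / real (Suc i)) \<le> 1 + ln (real n)"
  using assms
proof (induction n rule: dec_induct)
  case (step n)
  then have n: "real n > 0" by simp
  have "ln (real n / real (Suc n)) \<le> real n / real (Suc n) - 1"
    using n by (intro ln_le_minus_one) auto
  also have "\<dots> = - (1 / real (Suc n))" by (simp add: field_simps)
  finally have "1 / real (Suc n) \<le> ln (real (Suc n)) - ln (real n)"
    using n by (simp add: ln_div del: of_nat_Suc)
  then show ?case using step.IH by simp
qed simp

text \<open>With \<rho> = Re \<mu> / b these are the three rates of the theorem, up to the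
  constant.\<close>

definition growth_rate :: "real \<Rightarrow> nat \<Rightarrow> nat \<Rightarrow> real" where
  "growth_rate \<rho> \<nu> n = (if \<rho> < 1 / 2 then real n powr (1 / 2)
     else if \<rho> = 1 / 2 then real n powr (1 / 2) * ln (real n) powr (real \<nu> + 1 / 2)
     else real n powr \<rho> * ln (real n) ^ \<nu>)"

lemma growth_rate_nonneg: "n \<ge> 1 \<Longrightarrow> growth_rate \<rho> \<nu> n \<ge> 0"
  by (simp add: growth_rate_def)

lemma growth_square:
  assumes "i < n"
  shows "(growth \<rho> \<nu> n i)\<^sup>2
    = (real n / real (Suc i)) powr (2 * \<rho>) * (1 + ln (real n / real (Suc i))) ^ (2 * \<nu>)"
proof -
  have "((real n / real (Suc i)) powr \<rho>)\<^sup>2 = (real n / real (Suc i)) powr (2 * \<rho>)"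
    by (simp add: power2_eq_square flip: powr_add)
  then show ?thesis by (simp add: growth_def power_mult_distrib power_even_eq)
qed

text \<open>The leading factor is (n / (i + 1))^(2 \<rho>). For \<rho> < 1/2 a slightly larger
  exponent below 1 absorbs the logarithms, and the sum is of order n; for \<rho> = 1/2 the harmonic
  sum contributes one more logarithm; for \<rho> > 1/2 the series over i converges and the
  logarithms are bounded by their largest size.\<close>

lemma sum_growth_square:
  obtains C where "C \<ge> 0" and "\<And>n. n \<ge> 2 \<Longrightarrow> (\<Sum>i<n. (growth \<rho> \<nu> n i)\<^sup>2) \<le> C * (growth_rate \<rho> \<nu> n)\<^sup>2"
proof -
  have ln_ratio: "1 + ln (real n / real (Suc i)) \<le> 1 + ln (real n)" "0 \<le> ln (real n / real (Suc i))"
    if "i < n" for i n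
    using that by (simp_all add: ln_div)
  \<comment> \<open>From 1 \<le> ln n / ln 2, which is where n \<ge> 2 enters.\<close>
  define c where "c = 1 + 1 / ln (2::real)"
  have c: "1 + ln (real n) \<le> c * ln (real n)" "ln (real n) > 0" "1 + ln (real n) \<ge> 1" if "n \<ge> 2" for n
  proof -
    have l: "ln (real n) \<ge> ln 2" "ln (2::real) > 0" using that by auto
    then show "1 + ln (real n) \<le> c * ln (real n)" by (simp add: c_def field_simps)
    show "ln (real n) > 0" "1 + ln (real n) \<ge> 1" using l by linarith+
  qed
  have c_pos: "c > 0" by (simp add: c_def add_pos_pos)
  consider "\<rho> < 1 / 2" | "\<rho> = 1 / 2" | "\<rho> > 1 / 2" by linarith
  then show ?thesis
  proof cases
    case 1
    \<comment> \<open>Midway between max (2 \<rho>) 0 and 1; the maximum keeps s positive when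
      \<rho> is negative.\<close>
    define s where "s = (max (2 * \<rho>) 0 + 1) / 2"
    have s: "0 < s" "s < 1" "s > 2 * \<rho>" using 1 by (auto simp: s_def max_def)
    \<comment> \<open>So small that the 2 \<nu> logarithmic factors fit into the gap s - 2 \<rho>;
      the 1 in the denominator covers \<nu> = 0.\<close>
    define \<delta> where "\<delta> = min 1 ((s - 2 * \<rho>) / (2 * real \<nu> + 1))"
    have \<delta>: "0 < \<delta>" "\<delta> \<le> 1" using s by (auto simp: \<delta>_def)
    have "\<delta> * (2 * real \<nu>) \<le> (s - 2 * \<rho>) / (2 * real \<nu> + 1) * (2 * real \<nu>)"
      by (intro mult_right_mono) (auto simp: \<delta>_def)
    also have "\<dots> \<le> s - 2 * \<rho>" using s by (simp add: field_simps)
    finally have \<delta>s: "\<delta> * (2 * real \<nu>) \<le> s - 2 * \<rho>" .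
    show ?thesis
    proof (rule that[of "(1 / \<delta>) ^ (2 * \<nu>) / (1 - s)"])
      fix n :: nat assume n: "n \<ge> 2"
      have "(growth \<rho> \<nu> n i)\<^sup>2 \<le> (1 / \<delta>) ^ (2 * \<nu>) * (real n / real (Suc i)) powr s" if i: "i < n" for i
      proof -
        define x where "x = real n / real (Suc i)"
        have x: "x \<ge> 1" using i by (simp add: x_def)
        have "(1 + ln x) ^ (2 * \<nu>) \<le> (x powr \<delta> / \<delta>) ^ (2 * \<nu>)"
          using one_plus_ln_le_powr[OF x \<delta>] x by (intro power_mono) auto
        also have "\<dots> = (1 / \<delta>) ^ (2 * \<nu>) * x powr (\<delta> * (2 * real \<nu>))"
          using x by (simp add: power_divide powr_realpow[symmetric] powr_powr del: powr_realpow)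
        also have "\<dots> \<le> (1 / \<delta>) ^ (2 * \<nu>) * x powr (s - 2 * \<rho>)"
          using \<delta>s x \<delta> by (intro mult_left_mono powr_mono) auto
        finally have "x powr (2 * \<rho>) * (1 + ln x) ^ (2 * \<nu>)
            \<le> x powr (2 * \<rho>) * ((1 / \<delta>) ^ (2 * \<nu>) * x powr (s - 2 * \<rho>))"
          by (rule mult_left_mono) simp
        also have "\<dots> = (1 / \<delta>) ^ (2 * \<nu>) * x powr s" using x by (simp flip: powr_add)
        finally show ?thesis unfolding growth_square[OF i] x_def .
      qed
      then have "(\<Sum>i<n. (growth \<rho> \<nu> n i)\<^sup>2) \<le> (1 / \<delta>) ^ (2 * \<nu>) * (\<Sum>i<n. (real n / real (Suc i)) powr s)"
        unfolding sum_distrib_left by (intro sum_mono) auto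
      also have "\<dots> \<le> (1 / \<delta>) ^ (2 * \<nu>) * (real n / (1 - s))"
        using sum_powr_less_1[OF s(1,2)] \<delta> by (intro mult_left_mono) auto
      also have "\<dots> = (1 / \<delta>) ^ (2 * \<nu>) / (1 - s) * (growth_rate \<rho> \<nu> n)\<^sup>2"
        using 1 by (simp add: growth_rate_def powr_half_sqrt)
      finally show "(\<Sum>i<n. (growth \<rho> \<nu> n i)\<^sup>2) \<le> (1 / \<delta>) ^ (2 * \<nu>) / (1 - s) * (growth_rate \<rho> \<nu> n)\<^sup>2" .
    qed (use s \<delta> in auto)
  next
    case 2
    show ?thesis
    proof (rule that[of "c ^ (2 * \<nu> + 1)"])
      fix n :: nat assume n: "n \<ge> 2"
      have "(growth \<rho> \<nu> n i)\<^sup>2 \<le> real n * (1 + ln (real n)) ^ (2 * \<nu>) * (1 / real (Suc i))" if i: "i < n" for i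
        unfolding growth_square[OF i] 2
        using mult_left_mono[OF power_mono[OF ln_ratio(1)[OF i], of "2 * \<nu>"], of "real n / real (Suc i)"]
          ln_ratio(2)[OF i] by (simp add: mult_ac)
      then have "(\<Sum>i<n. (growth \<rho> \<nu> n i)\<^sup>2) \<le> real n * (1 + ln (real n)) ^ (2 * \<nu>) * (\<Sum>i<n. 1 / real (Suc i))"
        unfolding sum_distrib_left by (intro sum_mono) auto
      also have "\<dots> \<le> real n * (1 + ln (real n)) ^ (2 * \<nu>) * (1 + ln (real n))"
        using sum_inverse_le_ln[of n] n c(3)[OF n] by (intro mult_left_mono) auto
      also have "\<dots> = real n * (1 + ln (real n)) ^ (2 * \<nu> + 1)" by simp
      also have "\<dots> \<le> real n * (c * ln (real n)) ^ (2 * \<nu> + 1)"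
        using c[OF n] by (intro mult_left_mono power_mono) auto
      also have "\<dots> = c ^ (2 * \<nu> + 1) * (real n * ln (real n) ^ (2 * \<nu> + 1))"
        by (simp add: power_mult_distrib)
      also have "ln (real n) ^ (2 * \<nu> + 1) = (ln (real n) powr (real \<nu> + 1 / 2))\<^sup>2"
      proof -
        have "(ln (real n) powr (real \<nu> + 1 / 2))\<^sup>2 = ln (real n) powr (real (2 * \<nu> + 1))"
          by (simp add: power2_eq_square add.commute flip: powr_add)
        then show ?thesis using c(2)[OF n] by (simp only: powr_realpow)
      qed
      also have "real n * (ln (real n) powr (real \<nu> + 1 / 2))\<^sup>2 = (growth_rate \<rho> \<nu> n)\<^sup>2"
        by (simp add: growth_rate_def 2 powr_half_sqrt power_mult_distrib)
      finally show "(\<Sum>i<n. (growth \<rho> \<nu> n i)\<^sup>2) \<le> c ^ (2 * \<nu> + 1) * (growth_rate \<rho> \<nu> n)\<^sup>2" .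
    qed (use c_pos in auto)
  next
    case 3
    have sm: "summable (\<lambda>i. real (Suc i) powr (- (2 * \<rho>)))"
      using 3 summable_Suc_iff[of "\<lambda>i. real i powr (- (2 * \<rho>))"] by (simp add: summable_real_powr_iff)
    define Z where "Z = (\<Sum>i. real (Suc i) powr (- (2 * \<rho>)))"
    have Z: "Z \<ge> 0" unfolding Z_def by (rule suminf_nonneg[OF sm]) simp
    show ?thesis
    proof (rule that[of "c ^ (2 * \<nu>) * Z"])
      fix n :: nat assume n: "n \<ge> 2"
      have "(growth \<rho> \<nu> n i)\<^sup>2 \<le> real n powr (2 * \<rho>) * (1 + ln (real n)) ^ (2 * \<nu>) * real (Suc i) powr (- (2 * \<rho>))"
        if i: "i < n" for i
      proof -
        have eq: "(real n / real (Suc i)) powr (2 * \<rho>) = real n powr (2 * \<rho>) * real (Suc i) powr (- (2 * \<rho>))"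
          using powr_divide[of "real n" "real (Suc i)" "2 * \<rho>"] by (simp add: powr_minus_divide)
        moreover have "(growth \<rho> \<nu> n i)\<^sup>2 \<le> (real n / real (Suc i)) powr (2 * \<rho>) * (1 + ln (real n)) ^ (2 * \<nu>)"
          unfolding growth_square[OF i] using ln_ratio[OF i] by (intro mult_left_mono power_mono) auto
        ultimately show ?thesis unfolding eq by (simp only: mult.assoc mult.commute[of "(1 + ln (real n)) ^ (2 * \<nu>)"])
      qed
      then have "(\<Sum>i<n. (growth \<rho> \<nu> n i)\<^sup>2)
          \<le> real n powr (2 * \<rho>) * (1 + ln (real n)) ^ (2 * \<nu>) * (\<Sum>i<n. real (Suc i) powr (- (2 * \<rho>)))"
        unfolding sum_distrib_left by (intro sum_mono) auto
      also have "\<dots> \<le> real n powr (2 * \<rho>) * (c * ln (real n)) ^ (2 * \<nu>) * Z"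
      proof -
        have "(1 + ln (real n)) ^ (2 * \<nu>) \<le> (c * ln (real n)) ^ (2 * \<nu>)"
          by (rule power_mono[OF c(1)[OF n]]) (use c(3)[OF n] in linarith)
        moreover have "(\<Sum>i<n. real (Suc i) powr (- (2 * \<rho>))) \<le> Z"
          unfolding Z_def by (rule sum_le_suminf[OF sm]) auto
        ultimately show ?thesis by (intro mult_mono) (auto intro!: sum_nonneg)
      qed
      also have "\<dots> = c ^ (2 * \<nu>) * Z * (growth_rate \<rho> \<nu> n)\<^sup>2"
      proof -
        have "(real n powr \<rho>)\<^sup>2 = real n powr (2 * \<rho>)"
          by (simp add: power2_eq_square flip: powr_add)
        then show ?thesis using 3 by (simp add: growth_rate_def power_mult_distrib power_even_eq)
      qed
      finally show "(\<Sum>i<n. (growth \<rho> \<nu> n i)\<^sup>2) \<le> c ^ (2 * \<nu>) * Z * (growth_rate \<rho> \<nu> n)\<^sup>2" .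
    qed (use c_pos Z in auto)
  qed
qed

lemma sum_growth_square_plus:
  fixes K :: real
  assumes K: "K \<ge> 0"
  obtains C where "C \<ge> 0" and
    "\<And>n. n \<ge> 2 \<Longrightarrow> sqrt (1 + K * (\<Sum>i<n. (growth \<rho> \<nu> n i)\<^sup>2)) \<le> C * growth_rate \<rho> \<nu> n"
proof -
  obtain C where C: "C \<ge> 0" "\<And>n. n \<ge> 2 \<Longrightarrow> (\<Sum>i<n. (growth \<rho> \<nu> n i)\<^sup>2) \<le> C * (growth_rate \<rho> \<nu> n)\<^sup>2"
    using sum_growth_square by blast
  show ?thesis
  proof (rule that[of "sqrt ((1 + K) * C)"])
    fix n :: nat assume n: "n \<ge> 2"
    let ?S = "\<Sum>i<n. (growth \<rho> \<nu> n i)\<^sup>2"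
    \<comment> \<open>The last weight equals 1, so the square sum is at least 1 and absorbs the
      additional summand.\<close>
    have "1 = (growth \<rho> \<nu> n (n - 1))\<^sup>2" using n by (simp add: growth_def)
    also have "\<dots> \<le> ?S" using n by (intro member_le_sum) auto
    finally have "1 + K * ?S \<le> (1 + K) * ?S" by (simp add: distrib_right)
    also have "\<dots> \<le> (1 + K) * (C * (growth_rate \<rho> \<nu> n)\<^sup>2)"
      using K C(2)[OF n] by (intro mult_left_mono) auto
    finally have "sqrt (1 + K * ?S) \<le> sqrt ((1 + K) * C * (growth_rate \<rho> \<nu> n)\<^sup>2)"
      by (simp add: mult.assoc)
    then show "sqrt (1 + K * ?S) \<le> sqrt ((1 + K) * C) * growth_rate \<rho> \<nu> n"
      using growth_rate_nonneg[of n \<rho> \<nu>] n by (simp add: real_sqrt_mult)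
  qed (use K C in auto)
qed

section \<open>Fluctuations\<close>

text \<open>Needed because A - \<mu> raises the degree by one; the excess term at
  \<open>Suc \<nu>\<close> will vanish by nilpotency.\<close>

lemma sum_shift_coefficients:
  fixes u :: "nat \<Rightarrow> complex^'q"
  shows "(\<Sum>m\<le>\<nu>. f m *s u (Suc m)) = (\<Sum>m\<le>\<nu>. (if m = 0 then 0 else f (m - 1)) *s u m) + f \<nu> *s u (Suc \<nu>)"
  by (induction \<nu>) simp_all

text \<open>Discrete variation of constants: each Y i is propagated separately from the step at
  which it enters. On the range of P the matrix A multiplies by \<mu> and adds the vector of the
  next degree, and this is the recursion of \<open>propagator\<close>.\<close>

lemma propagator_expansion:
  fixes A P :: "complex^'q^'q" and V Y :: "nat \<Rightarrow> complex^'q"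
  assumes comm: "\<And>v. P *v (A *v v) = A *v (P *v v)"
    and nil: "\<And>v. (eigen_shift A \<mu> ^^ Suc \<nu>) (P *v v) = 0"
    and V0: "V 0 = 0" and V: "\<And>n. V (Suc n) = V n + complex_of_real (1 / W n) *s (A *v V n) + Y n"
  shows "P *v V n = (\<Sum>i<n. \<Sum>m\<le>\<nu>. propagator W \<mu> i n m *s (eigen_shift A \<mu> ^^ m) (P *v Y i))"
proof (induction n)
  case (Suc n)
  define c where "c = complex_of_real (1 / W n)"
  define u where "u i m = (eigen_shift A \<mu> ^^ m) (P *v Y i)" for i m
  have Au: "A *v u i m = \<mu> *s u i m + u i (Suc m)" for i m
    by (simp add: u_def eigen_shift_def)
  have u0: "u i (Suc \<nu>) = 0" for i unfolding u_def by (rule nil)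
  have step: "(\<Sum>m\<le>\<nu>. propagator W \<mu> i n m *s u i m) + c *s (A *v (\<Sum>m\<le>\<nu>. propagator W \<mu> i n m *s u i m))
      = (\<Sum>m\<le>\<nu>. propagator W \<mu> i (Suc n) m *s u i m)" if "i < n" for i
  proof -
    let ?f = "propagator W \<mu> i n"
    have "(\<Sum>m\<le>\<nu>. ?f m *s u i m) + c *s (A *v (\<Sum>m\<le>\<nu>. ?f m *s u i m))
        = (\<Sum>m\<le>\<nu>. (1 + c * \<mu>) * ?f m *s u i m) + c *s (\<Sum>m\<le>\<nu>. ?f m *s u i (Suc m))"
      by (simp add: vec_eq_iff vec.sum vec.scale Au sum_distrib_left sum.distrib[symmetric] algebra_simps)
    also have "\<dots> = (\<Sum>m\<le>\<nu>. (1 + c * \<mu>) * ?f m *s u i m) + c *s (\<Sum>m\<le>\<nu>. (if m = 0 then 0 else ?f (m - 1)) *s u i m)"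
      unfolding sum_shift_coefficients u0 by simp
    also have "\<dots> = (\<Sum>m\<le>\<nu>. ((1 + c * \<mu>) * ?f m + c * (if m = 0 then 0 else ?f (m - 1))) *s u i m)"
      by (simp add: vec_eq_iff sum_distrib_left sum.distrib[symmetric] algebra_simps)
    also have "\<dots> = (\<Sum>m\<le>\<nu>. propagator W \<mu> i (Suc n) m *s u i m)"
      using that by (intro sum.cong refl arg_cong2[where f = vector_scalar_mult]) (simp add: c_def divide_inverse mult_ac)
    finally show ?thesis .
  qed
  \<comment> \<open>The noise that enters at this step has coefficient 1 in degree 0 and none in
    higher degrees.\<close>
  have new: "(\<Sum>m\<le>\<nu>. propagator W \<mu> n (Suc n) m *s u n m) = u n 0"
  proof -
    have "propagator W \<mu> n (Suc n) m = (if m = 0 then 1 else 0)" for m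
      by (simp add: propagator_eq_0)
    then have "(\<Sum>m\<le>\<nu>. propagator W \<mu> n (Suc n) m *s u n m) = (\<Sum>m\<le>\<nu>. if m = 0 then u n m else 0)"
      by (intro sum.cong) (simp_all del: propagator.simps)
    then show ?thesis by (simp del: propagator.simps)
  qed
  have "P *v V (Suc n) = P *v V n + c *s (A *v (P *v V n)) + u n 0"
    by (simp add: V vec.add vec.scale comm c_def u_def)
  also have "P *v V n = (\<Sum>i<n. \<Sum>m\<le>\<nu>. propagator W \<mu> i n m *s u i m)"
    using Suc by (simp add: u_def)
  also have "\<dots> + c *s (A *v \<dots>)
      = (\<Sum>i<n. (\<Sum>m\<le>\<nu>. propagator W \<mu> i n m *s u i m) + c *s (A *v (\<Sum>m\<le>\<nu>. propagator W \<mu> i n m *s u i m)))"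
    by (simp only: vec.sum[of A] vec.scale_sum_right sum.distrib)
  also have "\<dots> = (\<Sum>i<n. \<Sum>m\<le>\<nu>. propagator W \<mu> i (Suc n) m *s u i m)"
    by (intro sum.cong refl step) simp
  finally show ?case unfolding new[symmetric] by (simp add: u_def)
qed (simp add: V0)

text \<open>The moment inequality for martingales is about real sums. Expanding the noise in unit
  vectors and splitting the coefficients into real and imaginary parts leaves finitely many real
  sums times fixed vectors, so \<beta> depends on neither n nor the coefficients.\<close>

lemma norm_propagator_expansion:
  fixes A P :: "complex^'q^'q"
  obtains \<beta> where "\<beta> \<ge> 0" and "\<And>(c :: nat \<Rightarrow> nat \<Rightarrow> complex) y n.
    norm (\<Sum>i<n. \<Sum>m\<le>\<nu>. c i m *s (eigen_shift A \<mu> ^^ m) (P *v complex_vec (y i)))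
    \<le> \<beta> * (\<Sum>(m, l, t) \<in> {..\<nu>} \<times> (UNIV :: 'q set) \<times> (UNIV :: bool set).
          \<bar>\<Sum>i<n. (if t then Re (c i m) else Im (c i m)) * y i $ l\<bar>)"
proof -
  define v where "v m l = (eigen_shift A \<mu> ^^ m) (P *v axis l 1)" for m and l :: 'q
  define \<beta> where "\<beta> = (\<Sum>m\<le>\<nu>. \<Sum>l\<in>UNIV. norm (v m l))"
  show ?thesis
  proof (rule that[of \<beta>])
    fix c :: "nat \<Rightarrow> nat \<Rightarrow> complex" and y :: "nat \<Rightarrow> real^'q" and n
    let ?S = "\<lambda>m l t. \<bar>\<Sum>i<n. (if t then Re (c i m) else Im (c i m)) * y i $ l\<bar>"
    have cv: "complex_vec x = (\<Sum>l\<in>UNIV. complex_of_real (x $ l) *s axis l 1)" for x :: "real^'q"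
      by (simp add: vec_eq_iff complex_vec_def axis_def if_distrib cong: if_cong)
    have "(\<Sum>i<n. \<Sum>m\<le>\<nu>. c i m *s (eigen_shift A \<mu> ^^ m) (P *v complex_vec (y i)))
        = (\<Sum>i<n. \<Sum>m\<le>\<nu>. \<Sum>l\<in>UNIV. (c i m * complex_of_real (y i $ l)) *s v m l)"
      by (simp add: cv vec.sum[of P] vec.scale[of P] shift_pow_sum shift_pow_scale v_def vec.scale_sum_right)
    also have "\<dots> = (\<Sum>m\<le>\<nu>. \<Sum>i<n. \<Sum>l\<in>UNIV. (c i m * complex_of_real (y i $ l)) *s v m l)"
      by (rule sum.swap)
    also have "\<dots> = (\<Sum>m\<le>\<nu>. \<Sum>l\<in>UNIV. \<Sum>i<n. (c i m * complex_of_real (y i $ l)) *s v m l)"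
      by (intro sum.cong refl sum.swap)
    also have "\<dots> = (\<Sum>m\<le>\<nu>. \<Sum>l\<in>UNIV. (\<Sum>i<n. c i m * complex_of_real (y i $ l)) *s v m l)"
      by (simp add: vec.scale_sum_left)
    also have "norm \<dots> \<le> (\<Sum>m\<le>\<nu>. \<Sum>l\<in>UNIV. norm ((\<Sum>i<n. c i m * complex_of_real (y i $ l)) *s v m l))"
      by (intro order_trans[OF norm_sum] sum_mono norm_sum)
    also have "\<dots> \<le> (\<Sum>m\<le>\<nu>. \<Sum>l\<in>UNIV. \<beta> * (?S m l True + ?S m l False))"
    proof (intro sum_mono)
      fix m l assume m: "m \<in> {..\<nu>}"
      let ?z = "\<Sum>i<n. c i m * complex_of_real (y i $ l)"
      have "norm (?z *s v m l) = cmod ?z * norm (v m l)"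
        by (simp add: norm_vec_def L2_set_def norm_mult power_mult_distrib real_sqrt_mult flip: sum_distrib_left)
      also have "\<dots> \<le> (\<bar>Re ?z\<bar> + \<bar>Im ?z\<bar>) * \<beta>"
      proof (rule mult_mono[OF cmod_le])
        have "norm (v m l) \<le> (\<Sum>l\<in>UNIV. norm (v m l))" by (rule member_le_sum) auto
        also have "\<dots> \<le> \<beta>" unfolding \<beta>_def
          using m by (intro member_le_sum[of m "{..\<nu>}" "\<lambda>m. \<Sum>l\<in>UNIV. norm (v m l)"] sum_nonneg) auto
        finally show "norm (v m l) \<le> \<beta>" .
      qed auto
      finally show "norm (?z *s v m l) \<le> \<beta> * (?S m l True + ?S m l False)"
        by (simp add: mult.commute)
    qed
    also have "\<dots> = \<beta> * (\<Sum>(m, l, t) \<in> {..\<nu>} \<times> (UNIV :: 'q set) \<times> (UNIV :: bool set). ?S m l t)"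
      by (simp add: sum.cartesian_product[symmetric] UNIV_bool sum_distrib_left add.commute)
    finally show "norm (\<Sum>i<n. \<Sum>m\<le>\<nu>. c i m *s (eigen_shift A \<mu> ^^ m) (P *v complex_vec (y i)))
      \<le> \<beta> * (\<Sum>(m, l, t) \<in> {..\<nu>} \<times> (UNIV :: 'q set) \<times> (UNIV :: bool set). ?S m l t)" .
  qed (simp add: \<beta>_def sum_nonneg)
qed

text \<open>Each summand is at most the largest one; the constant is crude but depends only on p and
  the cardinality.\<close>

lemma sum_powr_le:
  fixes x :: "'k \<Rightarrow> real"
  assumes "finite K" and "p \<ge> 0" and x: "\<And>k. k \<in> K \<Longrightarrow> x k \<ge> 0"
  shows "(\<Sum>k\<in>K. x k) powr p \<le> real (card K) powr p * (\<Sum>k\<in>K. x k powr p)"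
proof (cases "K = {}")
  case False
  have "Max (x ` K) \<in> x ` K" using assms(1) False by (intro Max_in) auto
  then obtain k where k: "Max (x ` K) = x k" "k \<in> K" by (rule imageE)
  have x_le: "x l \<le> x k" if "l \<in> K" for l
    unfolding k(1)[symmetric] using assms(1) that by (intro Max_ge) auto
  have "(\<Sum>k\<in>K. x k) \<le> real (card K) * x k"
    using x_le by (intro sum_bounded_above)
  then have "(\<Sum>k\<in>K. x k) powr p \<le> (real (card K) * x k) powr p"
    using assms by (intro powr_mono2 sum_nonneg) auto
  also have "\<dots> = real (card K) powr p * x k powr p" using x k by (simp add: powr_mult)
  also have "\<dots> \<le> real (card K) powr p * (\<Sum>k\<in>K. x k powr p)"
    using assms(1) k(2) by (intro mult_left_mono member_le_sum) auto
  finally show ?thesis .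
qed simp

text \<open>The pointwise bound \<open>sum_powr_le\<close> takes the place of Minkowski's
  inequality. Of the two powers of the cardinality, one comes from that bound and the other from
  adding up the moments before the p-th root.\<close>

lemma Lp_norm_le_of_sum:
  fixes Y :: "'w \<Rightarrow> 'b :: {real_normed_vector, second_countable_topology}" and S :: "'k \<Rightarrow> 'w \<Rightarrow> real"
  assumes K: "finite K" and p: "p > 0" and \<beta>: "\<beta> \<ge> 0" and G: "G \<ge> 0"
    and Y: "Y \<in> borel_measurable M" and le: "\<And>w. w \<in> space M \<Longrightarrow> norm (Y w) \<le> \<beta> * (\<Sum>k\<in>K. \<bar>S k w\<bar>)"
    and int: "\<And>k. k \<in> K \<Longrightarrow> integrable M (\<lambda>w. \<bar>S k w\<bar> powr p)"
    and S: "\<And>k. k \<in> K \<Longrightarrow> (\<integral>w. \<bar>S k w\<bar> powr p \<partial>M) \<le> G powr (p / 2)"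
  shows "Lp_finite M p Y"
    and "Lp_norm M p Y \<le> \<beta> * real (card K) * real (card K) powr (1 / p) * sqrt G"
proof -
  let ?c = "real (card K)"
  let ?R = "\<lambda>w. \<beta> powr p * (?c powr p * (\<Sum>k\<in>K. \<bar>S k w\<bar> powr p))"
  have le': "norm (Y w) powr p \<le> ?R w" if "w \<in> space M" for w
  proof -
    have "norm (Y w) powr p \<le> (\<beta> * (\<Sum>k\<in>K. \<bar>S k w\<bar>)) powr p"
      using le[OF that] p by (intro powr_mono2) auto
    also have "\<dots> = \<beta> powr p * (\<Sum>k\<in>K. \<bar>S k w\<bar>) powr p" using \<beta> by (simp add: powr_mult sum_nonneg)
    also have "\<dots> \<le> ?R w" using p K by (intro mult_left_mono sum_powr_le) auto
    finally show ?thesis .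
  qed
  have intR: "integrable M ?R" using int by auto
  have intY: "integrable M (\<lambda>w. norm (Y w) powr p)"
  proof (rule Bochner_Integration.integrable_bound[OF intR])
    show "(\<lambda>w. norm (Y w) powr p) \<in> borel_measurable M" using Y by measurable
    show "AE w in M. norm (norm (Y w) powr p) \<le> norm (?R w)"
      using le' by (intro AE_I2) (auto intro: order_trans[OF _ abs_ge_self])
  qed
  then show "Lp_finite M p Y" by (simp add: Lp_finite_def)
  have "(\<integral>w. norm (Y w) powr p \<partial>M) \<le> (\<integral>w. ?R w \<partial>M)"
    by (rule integral_mono[OF intY intR le'])
  also have "\<dots> = \<beta> powr p * (?c powr p * (\<Sum>k\<in>K. \<integral>w. \<bar>S k w\<bar> powr p \<partial>M))"
    using int by simp
  also have "\<dots> \<le> \<beta> powr p * (?c powr p * (?c * G powr (p / 2)))"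
    using S by (intro mult_left_mono sum_bounded_above) auto
  finally have "Lp_norm M p Y \<le> (\<beta> powr p * (?c powr p * (?c * G powr (p / 2)))) powr (1 / p)"
    unfolding Lp_norm_def using p by (intro powr_mono2) auto
  also have "\<dots> = \<beta> * ?c * ?c powr (1 / p) * sqrt G"
    using p \<beta> G by (simp add: powr_mult powr_powr powr_half_sqrt)
  finally show "Lp_norm M p Y \<le> \<beta> * ?c * ?c powr (1 / p) * sqrt G" .
qed

lemma measurable_matrix_complex_vec:
  fixes P :: "complex^'q^'q" and f :: "'w \<Rightarrow> real^'q"
  assumes "f \<in> borel_measurable M"
  shows "(\<lambda>w. P *v complex_vec (f w)) \<in> borel_measurable M"
proof -
  have "linear (\<lambda>x::real^'q. P *v complex_vec x)"
  proof (rule linearI)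
    fix x y :: "real^'q" and r :: real
    have "complex_vec (x + y) = complex_vec x + complex_vec y"
      by (simp add: complex_vec_def vec_eq_iff)
    then show "P *v complex_vec (x + y) = P *v complex_vec x + P *v complex_vec y"
      by (simp add: vec.add)
    have "complex_vec (r *\<^sub>R x) = complex_of_real r *s complex_vec x"
      by (simp add: complex_vec_def vec_eq_iff)
    then have "P *v complex_vec (r *\<^sub>R x) = complex_of_real r *s (P *v complex_vec x)"
      by (simp only: vec.scale)
    then show "P *v complex_vec (r *\<^sub>R x) = r *\<^sub>R (P *v complex_vec x)"
      by (simp add: vec_eq_iff scaleR_conv_of_real[where 'a = complex])
  qed
  then have "continuous_on UNIV (\<lambda>x::real^'q. P *v complex_vec x)"
    by (intro linear_continuous_on) (simp add: linear_conv_bounded_linear)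
  then show ?thesis
    using measurable_compose[OF assms borel_measurable_continuous_onI] by blast
qed

section \<open>From the noise to the projected fluctuation\<close>

context balanced_urn
begin

lemma noise_sum_moment:
  obtains K where "K > 0" and "\<And>\<gamma> g n l. (\<And>i. i < n \<Longrightarrow> \<bar>\<gamma> i\<bar> \<le> g i) \<Longrightarrow> (\<And>i. i < n \<Longrightarrow> g i > 0) \<Longrightarrow>
      integrable M (\<lambda>w. \<bar>\<Sum>i<n. \<gamma> i * noise i w $ l\<bar> powr p) \<and>
      (\<integral>w. \<bar>\<Sum>i<n. \<gamma> i * noise i w $ l\<bar> powr p \<partial>M) \<le> (1 + K * (\<Sum>i<n. (g i)\<^sup>2)) powr (p / 2)"
proof -
  obtain B where B: "\<And>n j. integrable M (\<lambda>w. \<bar>noise n w $ j\<bar> powr p)"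
    "\<And>n j. (\<integral>w. \<bar>noise n w $ j\<bar> powr p \<partial>M) \<le> B"
    using noise_moment by blast
  \<comment> \<open>Packaged as a predicate so that one constant for each coordinate can be
    chosen.\<close>
  define good where "good K l \<longleftrightarrow> (\<forall>\<gamma> g n. (\<forall>i<n. \<bar>\<gamma> i\<bar> \<le> g i) \<longrightarrow> (\<forall>i<n. g i > 0) \<longrightarrow>
      integrable M (\<lambda>w. \<bar>\<Sum>i<n. \<gamma> i * noise i w $ l\<bar> powr p) \<and>
      (\<integral>w. \<bar>\<Sum>i<n. \<gamma> i * noise i w $ l\<bar> powr p \<partial>M) \<le> (1 + K * (\<Sum>i<n. (g i)\<^sup>2)) powr (p / 2))" for K :: real and l
  have "\<exists>K>0. good K l" for l
  proof (rule martingale_sum_bound[where F = past and Y = "\<lambda>i w. noise i w $ l" and M = M and B = B and p = p])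
    fix K :: real
    assume "K > 0" and "\<And>\<gamma> g n. (\<And>i. i < n \<Longrightarrow> \<bar>\<gamma> i\<bar> \<le> g i) \<Longrightarrow> (\<And>i. i < n \<Longrightarrow> g i > 0) \<Longrightarrow>
      integrable M (\<lambda>w. \<bar>\<Sum>i<n. \<gamma> i * noise i w $ l\<bar> powr p) \<and>
      (\<integral>w. \<bar>\<Sum>i<n. \<gamma> i * noise i w $ l\<bar> powr p \<partial>M) \<le> (1 + K * (\<Sum>i<n. (g i)\<^sup>2)) powr (p / 2)"
    then show "\<exists>K>0. good K l" unfolding good_def by blast
  qed (use p B subalgebra_past noise_past_measurable noise_orthogonal prob_space_axioms in auto)
  then obtain k where k: "\<And>l. k l > 0 \<and> good (k l) l" by metis
  show ?thesis
  \<comment> \<open>The sum of the positive constants dominates each of them, which removes the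
    dependence on the coordinate.\<close>
  proof (rule that[of "\<Sum>l\<in>UNIV. k l"])
    show "(\<Sum>l\<in>UNIV. k l) > 0" using k by (intro sum_pos) auto
    fix \<gamma> g :: "nat \<Rightarrow> real" and n and l :: 'q
    assume "\<And>i. i < n \<Longrightarrow> \<bar>\<gamma> i\<bar> \<le> g i" "\<And>i. i < n \<Longrightarrow> g i > 0"
    then have *: "integrable M (\<lambda>w. \<bar>\<Sum>i<n. \<gamma> i * noise i w $ l\<bar> powr p) \<and>
      (\<integral>w. \<bar>\<Sum>i<n. \<gamma> i * noise i w $ l\<bar> powr p \<partial>M) \<le> (1 + k l * (\<Sum>i<n. (g i)\<^sup>2)) powr (p / 2)"
      using k[of l] unfolding good_def by blast
    have "k l \<le> (\<Sum>l\<in>UNIV. k l)" using k by (intro member_le_sum) (auto intro: less_imp_le)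
    then have "(1 + k l * (\<Sum>i<n. (g i)\<^sup>2)) powr (p / 2) \<le> (1 + (\<Sum>l\<in>UNIV. k l) * (\<Sum>i<n. (g i)\<^sup>2)) powr (p / 2)"
      using p k[of l] by (intro powr_mono2 add_left_mono mult_right_mono add_nonneg_nonneg mult_nonneg_nonneg sum_nonneg)
        (auto intro: less_imp_le)
    then show "integrable M (\<lambda>w. \<bar>\<Sum>i<n. \<gamma> i * noise i w $ l\<bar> powr p) \<and>
      (\<integral>w. \<bar>\<Sum>i<n. \<gamma> i * noise i w $ l\<bar> powr p \<partial>M) \<le> (1 + (\<Sum>l\<in>UNIV. k l) * (\<Sum>i<n. (g i)\<^sup>2)) powr (p / 2)"
      using * by auto
  qed
qed

text \<open>The moment bound is used with D times \<open>growth\<close> as majorant of the real and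
  imaginary parts of the propagator; squaring these majorants produces the factor
  \<open>K * D\<^sup>2\<close>.\<close>

lemma projected_fluctuation_bound:
  fixes \<mu> :: complex and P :: "complex^'q^'q"
  defines "A \<equiv> intensity_matrix N a \<xi>"
  assumes comm: "\<And>v. P *v (A *v v) = A *v (P *v v)"
    and nil: "\<And>v. (eigen_shift A \<mu> ^^ Suc \<nu>) (P *v v) = 0"
  obtains C where "\<And>n. n \<ge> 2 \<Longrightarrow> Lp_finite M p (\<lambda>w. P *v complex_vec (fluctuation n w)) \<and>
    Lp_norm M p (\<lambda>w. P *v complex_vec (fluctuation n w)) \<le> C * growth_rate (Re \<mu> / b) \<nu> n"
proof -
  obtain K where K: "K > 0" and moment: "\<And>\<gamma> g n l. (\<And>i. i < n \<Longrightarrow> \<bar>\<gamma> i\<bar> \<le> g i) \<Longrightarrow> (\<And>i. i < n \<Longrightarrow> g i > 0) \<Longrightarrow>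
      integrable M (\<lambda>w. \<bar>\<Sum>i<n. \<gamma> i * noise i w $ l\<bar> powr p) \<and>
      (\<integral>w. \<bar>\<Sum>i<n. \<gamma> i * noise i w $ l\<bar> powr p \<partial>M) \<le> (1 + K * (\<Sum>i<n. (g i)\<^sup>2)) powr (p / 2)"
    using noise_sum_moment by blast
  define c where "c = propagator W \<mu>"
  obtain D where D: "D > 0" and c: "\<And>i n m. i < n \<Longrightarrow> m \<le> \<nu> \<Longrightarrow> cmod (c i n m) \<le> D * growth (Re \<mu> / b) \<nu> n i"
    using propagator_growth[OF w0_pos b_pos] unfolding c_def by blast
  obtain \<beta> where \<beta>: "\<beta> \<ge> 0" and le: "\<And>(c :: nat \<Rightarrow> nat \<Rightarrow> complex) y n.
    norm (\<Sum>i<n. \<Sum>m\<le>\<nu>. c i m *s (eigen_shift A \<mu> ^^ m) (P *v complex_vec (y i)))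
    \<le> \<beta> * (\<Sum>(m, l, t) \<in> {..\<nu>} \<times> (UNIV :: 'q set) \<times> (UNIV :: bool set).
          \<bar>\<Sum>i<n. (if t then Re (c i m) else Im (c i m)) * y i $ l\<bar>)"
    using norm_propagator_expansion by blast
  obtain E where E: "E \<ge> 0" and rate: "\<And>n. n \<ge> 2 \<Longrightarrow>
      sqrt (1 + K * D\<^sup>2 * (\<Sum>i<n. (growth (Re \<mu> / b) \<nu> n i)\<^sup>2)) \<le> E * growth_rate (Re \<mu> / b) \<nu> n"
    using sum_growth_square_plus[of "K * D\<^sup>2"] K by (metis less_imp_le mult_nonneg_nonneg zero_le_power2)
  let ?K = "{..\<nu>} \<times> (UNIV :: 'q set) \<times> (UNIV :: bool set)"
  let ?k = "real (card ?K)"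
  show ?thesis
  proof (rule that[of "\<beta> * ?k * ?k powr (1 / p) * E"])
    fix n :: nat assume n: "n \<ge> 2"
    define G where "G = 1 + K * D\<^sup>2 * (\<Sum>i<n. (growth (Re \<mu> / b) \<nu> n i)\<^sup>2)"
    define part where "part t z = (if t then Re z else Im z)" for t and z :: complex
    define S where "S = (\<lambda>(m, l, t) w. \<Sum>i<n. part t (c i n m) * noise i w $ l)"
    have G: "G \<ge> 0" unfolding G_def using K by (intro add_nonneg_nonneg mult_nonneg_nonneg sum_nonneg) auto
    have S: "integrable M (\<lambda>w. \<bar>S k w\<bar> powr p)" "(\<integral>w. \<bar>S k w\<bar> powr p \<partial>M) \<le> G powr (p / 2)" if "k \<in> ?K" for k
    proof -
      obtain m l t where k: "k = (m, l, t)" by (cases k)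
      then have m: "m \<le> \<nu>" using that by auto
      have "\<bar>part t (c i n m)\<bar> \<le> D * growth (Re \<mu> / b) \<nu> n i" if "i < n" for i
        using c[OF that m] abs_Re_le_cmod[of "c i n m"] abs_Im_le_cmod[of "c i n m"]
        by (auto simp: part_def intro: order_trans)
      moreover have "D * growth (Re \<mu> / b) \<nu> n i > 0" if "i < n" for i
        using growth_pos[OF that] D by simp
      ultimately have "integrable M (\<lambda>w. \<bar>\<Sum>i<n. part t (c i n m) * noise i w $ l\<bar> powr p) \<and>
          (\<integral>w. \<bar>\<Sum>i<n. part t (c i n m) * noise i w $ l\<bar> powr p \<partial>M)
            \<le> (1 + K * (\<Sum>i<n. (D * growth (Re \<mu> / b) \<nu> n i)\<^sup>2)) powr (p / 2)"
        by (rule moment)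
      then show "integrable M (\<lambda>w. \<bar>S k w\<bar> powr p)" "(\<integral>w. \<bar>S k w\<bar> powr p \<partial>M) \<le> G powr (p / 2)"
        by (simp_all add: k S_def G_def power_mult_distrib mult.assoc sum_distrib_left)
    qed
    have sum_le: "norm (P *v complex_vec (fluctuation n w)) \<le> \<beta> * (\<Sum>k\<in>?K. \<bar>S k w\<bar>)" if w: "w \<in> space M" for w
    proof -
      have 0: "complex_vec (fluctuation 0 w) = 0"
        by (simp add: fluctuation_0[OF w] complex_vec_def vec_eq_iff)
      have "P *v complex_vec (fluctuation n w)
          = (\<Sum>i<n. \<Sum>m\<le>\<nu>. c i n m *s (eigen_shift A \<mu> ^^ m) (P *v complex_vec (noise i w)))"
        unfolding c_def
        by (rule propagator_expansion[OF comm nil, where V = "\<lambda>n. complex_vec (fluctuation n w)"])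
          (use 0 fluctuation_Suc in \<open>auto simp: A_def\<close>)
      then show ?thesis
        using le[of "\<lambda>i. c i n" "\<lambda>i. noise i w" n] by (simp add: S_def part_def case_prod_beta)
    qed
    have meas: "(\<lambda>w. P *v complex_vec (fluctuation n w)) \<in> borel_measurable M"
      unfolding fluctuation_def
      by (intro measurable_matrix_complex_vec borel_measurable_diff state_measurable borel_measurable_const)
    have fin: "finite ?K" and p0: "p > 0" using p by auto
    have Lp: "Lp_finite M p (\<lambda>w. P *v complex_vec (fluctuation n w))"
      "Lp_norm M p (\<lambda>w. P *v complex_vec (fluctuation n w)) \<le> \<beta> * ?k * ?k powr (1 / p) * sqrt G"
      by (rule Lp_norm_le_of_sum[OF fin p0 \<beta> G meas, where S = S], erule sum_le, erule S(1), erule S(2))+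
    have "\<beta> * ?k * ?k powr (1 / p) * sqrt G
        \<le> \<beta> * ?k * ?k powr (1 / p) * (E * growth_rate (Re \<mu> / b) \<nu> n)"
      unfolding G_def using \<beta> by (intro mult_left_mono rate[OF n]) auto
    then have "Lp_norm M p (\<lambda>w. P *v complex_vec (fluctuation n w))
        \<le> \<beta> * ?k * ?k powr (1 / p) * (E * growth_rate (Re \<mu> / b) \<nu> n)"
      by (rule order_trans[OF Lp(2)])
    then show "Lp_finite M p (\<lambda>w. P *v complex_vec (fluctuation n w)) \<and>
      Lp_norm M p (\<lambda>w. P *v complex_vec (fluctuation n w))
        \<le> \<beta> * ?k * ?k powr (1 / p) * E * growth_rate (Re \<mu> / b) \<nu> n"
      unfolding mult.assoc[of _ E] using Lp(1) by (rule conjI[rotated])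
  qed
qed

end

theorem theorem3p3:
  fixes M :: "'w measure" and N :: "'v measure"
    and a x0 :: "real^'q" and \<xi> :: "'q \<Rightarrow> 'v \<Rightarrow> real^'q"
    and X :: "nat \<Rightarrow> 'w \<Rightarrow> real^'q" and I :: "nat \<Rightarrow> 'w \<Rightarrow> 'q"
    and b p :: real and \<mu> :: complex and \<nu> :: nat
  assumes "polya_urn M N a \<xi> x0 X I"
    and "tenable M a X"
    and "balanced N a \<xi> b"
    and "p \<ge> 2"
    and "\<And>i j. integrable N (\<lambda>v. \<bar>\<xi> i v $ j\<bar> powr p)"
    and "\<mu> \<in> eigenvalues (intensity_matrix N a \<xi>)"
    and "largest_jordan_block (intensity_matrix N a \<xi>) \<mu> (\<nu> + 1)"
  shows "\<exists>C::real. \<forall>n\<ge>2.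
    (let P = spectral_projection (intensity_matrix N a \<xi>) \<mu>;
         Y = (\<lambda>w. P *v complex_vec (X n w - (\<integral>w'. X n w' \<partial>M)))
     in Lp_finite M p Y \<and>
        Lp_norm M p Y \<le>
          (if Re \<mu> < b / 2 then C * real n powr (1 / 2)
           else if Re \<mu> = b / 2 then C * real n powr (1 / 2) * ln (real n) powr (real \<nu> + 1 / 2)
           else C * real n powr (Re \<mu> / b) * ln (real n) ^ \<nu>))"
proof -
  interpret balanced_urn M N a \<xi> x0 X I b p
    using assms by (simp add: balanced_urn_def balanced_urn_axioms_def)
  let ?P = "spectral_projection (intensity_matrix N a \<xi>) \<mu>"
  \<comment> \<open>The size \<nu> + 1 of the largest block is the exponent that annihilates the
    range of the projection, so the degrees in the expansion end at \<nu>.\<close>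
  note spectral = spectral_projection_properties[OF assms(7), unfolded Suc_eq_plus1[symmetric]]
  have rate: "C * growth_rate (Re \<mu> / b) \<nu> n =
      (if Re \<mu> < b / 2 then C * real n powr (1 / 2)
       else if Re \<mu> = b / 2 then C * real n powr (1 / 2) * ln (real n) powr (real \<nu> + 1 / 2)
       else C * real n powr (Re \<mu> / b) * ln (real n) ^ \<nu>)" for C n
    using b_pos by (simp add: growth_rate_def divide_simps)
  show ?thesis
  proof (rule projected_fluctuation_bound[OF spectral])
    fix C assume "\<And>n. n \<ge> 2 \<Longrightarrow> Lp_finite M p (\<lambda>w. ?P *v complex_vec (fluctuation n w)) \<and>
      Lp_norm M p (\<lambda>w. ?P *v complex_vec (fluctuation n w)) \<le> C * growth_rate (Re \<mu> / b) \<nu> n"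
    then show ?thesis
      unfolding Let_def rate[symmetric] fluctuation_def[symmetric] by (intro exI[of _ C] allI impI)
  qed
qed

end
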